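(* Let $\Omega=\mathbb T^3$, $d=3$, $T>0$, $0<\kappa<1$, $0<r\le R<\infty$, let $\mu\in C^1([r,R])$ be increasing with $\mu\ge\underline c>0$ on $[r,R]$, and let $\varphi'(s)=\mu'(s)/s$. Let $(\varrho,\mathbf w)$, with $r\le\varrho\le R$, be a sufficiently smooth solution on $[0,T]\times\Omega$ of $$\partial_t\varrho+\operatorname{div}(\varrho\mathbf u)=0,$$ $$\partial_t(\varrho\mathbf w)+\operatorname{div}(\varrho\mathbf u\otimes\mathbf w)-2\operatorname{div}(\mu(\varrho)D(\mathbf u))+2\kappa\operatorname{div}(\mu(\varrho)\nabla^t\mathbf u)+\nabla\pi_1=\mathbf 0,$$ $$\mathbf w=\mathbf u+2\kappa\nabla\varphi(\varrho),\qquad\operatorname{div}\mathbf w=0.$$ Then $(\varrho,\mathbf w)$ satisfies $$\sup_{\tau\in[0,T]}\int_\Omega\varrho\Big(\frac{|\mathbf w|^2}{2}+(1-\kappa)\kappa\frac{|2\nabla\varphi(\varrho)|^2}{2}\Big)(\tau)\,dx+2\kappa\int_0^T\!\!\int_\Omega\mu(\varrho)|A(\mathbf w)|^2\,dx\,dt$$ $$+2(1-\kappa)\int_0^T\!\!\int_\Omega\mu(\varrho)\Big|D(\mathbf w-2\kappa\nabla\varphi(\varrho))+\frac{2\kappa}{d}\Delta\varphi(\varrho)\,\mathbf I\Big|^2dx\,dt$$ $$+2(1-\kappa)\int_0^T\!\!\int_\Omega\Big(\frac{1-d}{d}\mu(\varrho)+\mu'(\varrho)\varrho\Big)|2\kappa\Delta\varphi(\varrho)|^2\,dx\,dt\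 \le\ \int_\Omega\varrho\Big(\frac{|\mathbf w|^2}{2}+(1-\kappa)\kappa\frac{|2\nabla\varphi(\varrho)|^2}{2}\Big)(0)\,dx.$$
   Context: $\Omega=\mathbb T^3$ is the three-dimensional torus (periodic boundary conditions) and $d=3$ is the space dimension. $\varrho$ is the scalar density, $\mathbf u$ and $\mathbf w$ are vector fields, and $\mathbf u=\mathbf w-2\kappa\nabla\varphi(\varrho)$. $(\nabla\mathbf u)_{ij}=\partial_iu_j$, $\nabla^t\mathbf u$ is its transpose, $D(\mathbf u)=\frac12(\nabla\mathbf u+\nabla^t\mathbf u)$, $A(\mathbf u)=\frac12(\nabla\mathbf u-\nabla^t\mathbf u)$, $\mathbf I$ is the identity matrix, $(\mathbf a\otimes\mathbf b)_{ij}=a_ib_j$, $(\operatorname{div}M)_j=\partial_iM_{ij}$. The scalar function $\pi_1$ is a modified pressure, $\pi_1=\pi+2(\mu'(\varrho)\varrho-\mu(\varrho))\operatorname{div}\mathbf u-\lambda(\varrho)\operatorname{div}\mathbf u$, where $\pi$ is the unknown pressure and $\lambda(\varrho)$ is the second viscosity coefficient. "Sufficiently smooth" is informal: smooth enough that the equations can be multiplied by $\mathbf w$ and $\nabla\varphi(\varrho)$ and integrated by parts.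
   Formalization: The time integrals run over [0,τ] instead of [0,T], with the supremum over τ taken of the whole left-hand side; as displayed, τ=0 would force the total dissipation to be ≤ 0, which fails for constant density and a decaying shear flow. *)

theory Defs
  imports "HOL-Analysis.Analysis"
begin

text \<open>Functions on the torus \<open>\<real>\<^sup>3/\<int>\<^sup>3\<close> are functions on \<open>\<real>\<^sup>3\<close> that have
  period 1 in each coordinate; the integral over the torus is the integral over the unit cube.\<close>

definition torus_periodic :: "(real^3 \<Rightarrow> 'a) \<Rightarrow> bool" where
  "torus_periodic f \<longleftrightarrow> (\<forall>x i. f (x + axis i 1) = f x)"

definition torus_integral :: "(real^3 \<Rightarrow> real) \<Rightarrow> real" where
  "torus_integral f = integral (cbox 0 One) f"

definition pd :: "3 \<Rightarrow> (real^3 \<Rightarrow> 'a::real_normed_vector) \<Rightarrow> real^3 \<Rightarrow> 'a" where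
  "pd i f x = frechet_derivative f (at x) (axis i 1)"

text \<open>At \<open>t = 0\<close> and \<open>t = T\<close> the time derivative is one-sided.\<close>

definition dt :: "real \<Rightarrow> (real \<Rightarrow> real^3 \<Rightarrow> 'a::real_normed_vector) \<Rightarrow> real \<Rightarrow> real^3 \<Rightarrow> 'a" where
  "dt T f t x = vector_derivative (\<lambda>s. f s x) (at t within {0..T})"

definition grad :: "(real^3 \<Rightarrow> real) \<Rightarrow> real^3 \<Rightarrow> real^3" where
  "grad f x = (\<chi> i. pd i f x)"

definition divg :: "(real^3 \<Rightarrow> real^3) \<Rightarrow> real^3 \<Rightarrow> real" where
  "divg v x = (\<Sum>i\<in>UNIV. pd i (\<lambda>y. v y $ i) x)"

definition laplacian :: "(real^3 \<Rightarrow> real) \<Rightarrow> real^3 \<Rightarrow> real" where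
  "laplacian f = divg (grad f)"

text \<open>Convention: entry \<open>(i, j)\<close> of the gradient of \<open>v\<close> is the \<open>i\<close>-th partial derivative of the
  \<open>j\<close>-th component (the transpose of the Jacobian matrix), and the divergence of a matrix field
  is taken over the first index.\<close>

definition vgrad :: "(real^3 \<Rightarrow> real^3) \<Rightarrow> real^3 \<Rightarrow> real^3^3" where
  "vgrad v x = (\<chi> i j. pd i (\<lambda>y. v y $ j) x)"

definition mdiv :: "(real^3 \<Rightarrow> real^3^3) \<Rightarrow> real^3 \<Rightarrow> real^3" where
  "mdiv M x = (\<chi> j. \<Sum>i\<in>UNIV. pd i (\<lambda>y. M y $ i $ j) x)"

definition sym_grad :: "(real^3 \<Rightarrow> real^3) \<Rightarrow> real^3 \<Rightarrow> real^3^3" where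
  "sym_grad v x = (1/2) *\<^sub>R (vgrad v x + transpose (vgrad v x))"

definition skew_grad :: "(real^3 \<Rightarrow> real^3) \<Rightarrow> real^3 \<Rightarrow> real^3^3" where
  "skew_grad v x = (1/2) *\<^sub>R (vgrad v x - transpose (vgrad v x))"

definition tensor :: "real^3 \<Rightarrow> real^3 \<Rightarrow> real^3^3" where
  "tensor a b = (\<chi> i j. a $ i * b $ j)"

text \<open>Regularity on the closed slab \<open>[0,T] \<times> \<real>\<^sup>3\<close>: once continuously differentiable in the
  space variable (\<open>C1_space\<close>), respectively in space and time (\<open>C1_slab\<close>), with all the derivatives
  jointly continuous in \<open>(t, x)\<close>.\<close>

definition C1_space :: "real \<Rightarrow> (real \<Rightarrow> real^3 \<Rightarrow> 'a::real_normed_vector) \<Rightarrow> bool" where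
  "C1_space T f \<longleftrightarrow>
     continuous_on ({0..T} \<times> UNIV) (\<lambda>(t, x). f t x) \<and>
     (\<forall>t\<in>{0..T}. \<forall>x. f t differentiable (at x)) \<and>
     (\<forall>i. continuous_on ({0..T} \<times> UNIV) (\<lambda>(t, x). pd i (f t) x))"

definition C1_slab :: "real \<Rightarrow> (real \<Rightarrow> real^3 \<Rightarrow> 'a::real_normed_vector) \<Rightarrow> bool" where
  "C1_slab T f \<longleftrightarrow>
     C1_space T f \<and>
     (\<forall>t\<in>{0..T}. \<forall>x. (\<lambda>s. f s x) differentiable (at t within {0..T})) \<and>
     continuous_on ({0..T} \<times> UNIV) (\<lambda>(t, x). dt T f t x)"

text \<open>The smoothness required of a solution \<open>(\<rho>, w)\<close> with modified pressure \<open>p\<close>, where \<open>\<psi>\<close> stands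
  for \<open>\<phi>(\<rho>)\<close>: every term of the equations for \<open>\<rho>\<close> and \<open>w\<close>, and of the equation for the gradient
  of \<open>\<psi>\<close> that follows from them, makes sense classically. Since \<open>\<phi>\<close> is only \<open>C\<^sup>1\<close>, smoothness of
  \<open>\<psi>\<close> is not a consequence of smoothness of \<open>\<rho>\<close> and is required separately.\<close>

definition sufficiently_smooth ::
  "real \<Rightarrow> (real \<Rightarrow> real^3 \<Rightarrow> real) \<Rightarrow> (real \<Rightarrow> real^3 \<Rightarrow> real^3) \<Rightarrow> (real \<Rightarrow> real^3 \<Rightarrow> real) \<Rightarrow>
   (real \<Rightarrow> real^3 \<Rightarrow> real) \<Rightarrow> bool" where
  "sufficiently_smooth T \<rho> w \<psi> p \<longleftrightarrow>
     C1_slab T \<rho> \<and>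
     C1_slab T w \<and> (\<forall>i. C1_space T (\<lambda>t. pd i (w t))) \<and>
     C1_slab T \<psi> \<and> (\<forall>i. C1_slab T (\<lambda>t. pd i (\<psi> t))) \<and>
     (\<forall>i j. C1_space T (\<lambda>t. pd j (pd i (\<psi> t)))) \<and>
     C1_space T p"

end

theory Submission
  imports Defs
begin

text \<open>The asserted estimate is an energy equality. Write \<open>v\<close> for the gradient of
  \<open>\<psi> = \<phi>(\<rho>)\<close>, \<open>m = \<mu>(\<rho>)\<close> and \<open>U i j\<close> for \<open>\<partial>\<^sub>i u\<^sub>j\<close>. The choice \<open>\<phi>'(s) = \<mu>'(s)/s\<close> makes
  \<open>\<rho> v\<close> the gradient of \<open>m\<close>, and two balance laws result.

  Testing the momentum equation with \<open>w\<close> gives the rate of the kinetic energy. The pressure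
  drops out since \<open>w\<close> is divergence free, the convective term cancels against the continuity
  equation, and the stress \<open>2 m D(u) - 2 \<kappa> m \<nabla>\<^sup>t u\<close> contracted with the gradient of \<open>w\<close> remains
  (\<open>kinetic_energy_balance\<close>).

  Multiplied by \<open>\<phi>'(\<rho>)\<close>, the continuity equation becomes the transport equation
  \<open>\<partial>\<^sub>t \<psi> + u \<sqdot> v + \<mu>'(\<rho>) div u = 0\<close>. Testing it with \<open>- div(\<rho> v)\<close> amounts to testing its gradient
  with \<open>\<rho> v\<close>, but asks for one derivative less, which is why \<open>\<mu>\<close> of class \<open>C\<^sup>1\<close> suffices. It gives
  the rate of the energy of \<open>v\<close>: what remains is
  \<open>m (\<nabla>v : D(u) - \<Delta>\<psi> div u) + \<mu>'(\<rho>) \<rho> \<Delta>\<psi> div u\<close> (\<open>drift_energy_balance\<close>).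

  Add \<open>4\<kappa>(1 - \<kappa>)\<close> times the second rate to the first and insert \<open>u = w - 2\<kappa> v\<close>. As the gradient
  of \<open>v\<close> is symmetric and \<open>div u = - 2\<kappa> \<Delta>\<psi>\<close>, completing the square turns the sum into the negative
  of the three dissipation terms, pointwise in \<open>x\<close> (\<open>dissipation_identity\<close>). Integration over
  \<open>[0,\<tau>]\<close> yields the equality for every \<open>\<tau>\<close>, hence the bound for the supremum.

  All integrations by parts are instances of one fact, that a periodic \<open>C\<^sup>1\<close> vector field has
  divergence of integral zero: each balance law is a pointwise identity modulo the divergence of
  an explicit flux.\<close>

section \<open>Partial derivatives\<close>

lemma has_vector_derivative_pd:
  assumes "f differentiable (at (x + t *\<^sub>R axis i 1))"
  shows "((\<lambda>s. f (x + s *\<^sub>R axis i 1)) has_vector_derivative pd i f (x + t *\<^sub>R axis i 1)) (at t within S)"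
proof -
  have "((\<lambda>s::real. x + s *\<^sub>R axis i 1) has_vector_derivative axis i 1) (at t within S)"
    by (auto intro!: derivative_eq_intros)
  moreover have "(f has_derivative frechet_derivative f (at (x + t *\<^sub>R axis i 1)))
      (at (x + t *\<^sub>R axis i 1) within (\<lambda>s. x + s *\<^sub>R axis i 1) ` S)"
    using assms frechet_derivative_works has_derivative_at_withinI by blast
  ultimately show ?thesis
    unfolding pd_def by (rule vector_derivative_diff_chain_within[unfolded o_def])
qed

lemma pd_eqI:
  assumes "(f has_derivative f') (at x)"
  shows "pd i f x = f' (axis i 1)"
  using frechet_derivative_at[OF assms] by (simp add: pd_def)

lemma has_derivative_frechet:
  "f differentiable (at x) \<Longrightarrow> (f has_derivative frechet_derivative f (at x)) (at x)"
  by (simp add: frechet_derivative_works)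

lemma pd_add:
  assumes "f differentiable (at x)" "g differentiable (at x)"
  shows "pd i (\<lambda>y. f y + g y) x = pd i f x + pd i g x"
  using pd_eqI[OF has_derivative_add[OF has_derivative_frechet[OF assms(1)] has_derivative_frechet[OF assms(2)]]]
  by (simp add: pd_def)

lemma pd_diff:
  assumes "f differentiable (at x)" "g differentiable (at x)"
  shows "pd i (\<lambda>y. f y - g y) x = pd i f x - pd i g x"
  using pd_eqI[OF has_derivative_diff[OF has_derivative_frechet[OF assms(1)] has_derivative_frechet[OF assms(2)]]]
  by (simp add: pd_def)

lemma pd_mult:
  fixes f g :: "real^3 \<Rightarrow> real"
  assumes "f differentiable (at x)" "g differentiable (at x)"
  shows "pd i (\<lambda>y. f y * g y) x = f x * pd i g x + pd i f x * g x"
  using pd_eqI[OF has_derivative_mult[OF has_derivative_frechet[OF assms(1)] has_derivative_frechet[OF assms(2)]]]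
  by (simp add: pd_def)

lemma pd_const [simp]: "pd i (\<lambda>y. c) x = 0"
  by (rule pd_eqI[OF has_derivative_const])

lemma pd_linear:
  assumes "bounded_linear L" "f differentiable (at x)"
  shows "pd i (\<lambda>y. L (f y)) x = L (pd i f x)"
  using pd_eqI[OF bounded_linear.has_derivative[OF assms(1) has_derivative_frechet[OF assms(2)]]]
  by (simp add: pd_def)

lemma pd_sum:
  assumes "\<And>k. k \<in> K \<Longrightarrow> f k differentiable (at x)"
  shows "pd i (\<lambda>y. \<Sum>k\<in>K. f k y) x = (\<Sum>k\<in>K. pd i (f k) x)"
proof -
  have "((\<lambda>y. \<Sum>k\<in>K. f k y) has_derivative (\<lambda>h. \<Sum>k\<in>K. frechet_derivative (f k) (at x) h)) (at x)"
    by (intro has_derivative_sum has_derivative_frechet assms)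
  from pd_eqI[OF this] show ?thesis
    by (simp add: pd_def)
qed

text \<open>The second difference over a square is symmetric in the two directions, whereas the mean
  value theorem, applied first along \<open>i\<close> and then along \<open>j\<close>, represents it by the mixed
  derivative taken in that order.\<close>

lemma second_difference_mvt:
  fixes f :: "real^3 \<Rightarrow> real"
  assumes f: "\<And>x. f differentiable (at x)" and fi: "\<And>x. pd i f differentiable (at x)" and h: "h > 0"
  obtains \<xi> \<eta> where "0 < \<xi>" "\<xi> < h" "0 < \<eta>" "\<eta> < h"
    "f (x + h *\<^sub>R axis i 1 + h *\<^sub>R axis j 1) - f (x + h *\<^sub>R axis i 1) - f (x + h *\<^sub>R axis j 1) + f x
      = h\<^sup>2 * pd j (pd i f) (x + \<xi> *\<^sub>R axis i 1 + \<eta> *\<^sub>R axis j 1)"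
proof -
  have df: "((\<lambda>s. f (y + s *\<^sub>R axis i 1)) has_real_derivative pd i f (y + s *\<^sub>R axis i 1)) (at s)" for y s
    using has_vector_derivative_pd[OF f] by (simp add: has_real_derivative_iff_has_vector_derivative)
  have dfi: "((\<lambda>s. pd i f (y + s *\<^sub>R axis j 1)) has_real_derivative pd j (pd i f) (y + s *\<^sub>R axis j 1)) (at s)" for y s
    using has_vector_derivative_pd[OF fi] by (simp add: has_real_derivative_iff_has_vector_derivative)
  define \<phi> where "\<phi> s = f ((x + h *\<^sub>R axis j 1) + s *\<^sub>R axis i 1) - f (x + s *\<^sub>R axis i 1)" for s
  have d\<phi>: "(\<phi> has_real_derivative
      (pd i f ((x + h *\<^sub>R axis j 1) + s *\<^sub>R axis i 1) - pd i f (x + s *\<^sub>R axis i 1))) (at s)" for s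
    unfolding \<phi>_def by (intro DERIV_diff df)
  obtain \<xi> where \<xi>: "0 < \<xi>" "\<xi> < h"
    "\<phi> h - \<phi> 0 = h * (pd i f ((x + h *\<^sub>R axis j 1) + \<xi> *\<^sub>R axis i 1) - pd i f (x + \<xi> *\<^sub>R axis i 1))"
    using MVT2[OF h d\<phi>] by auto
  obtain \<eta> where \<eta>: "0 < \<eta>" "\<eta> < h"
    "pd i f ((x + \<xi> *\<^sub>R axis i 1) + h *\<^sub>R axis j 1) - pd i f ((x + \<xi> *\<^sub>R axis i 1) + 0 *\<^sub>R axis j 1)
      = h * pd j (pd i f) ((x + \<xi> *\<^sub>R axis i 1) + \<eta> *\<^sub>R axis j 1)"
    using MVT2[OF h dfi[of "x + \<xi> *\<^sub>R axis i 1"]] by auto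
  show thesis
    using that[OF \<xi>(1,2) \<eta>(1,2)] \<xi>(3) \<eta>(3)
    by (simp add: \<phi>_def algebra_simps power2_eq_square)
qed

text \<open>Both mixed derivatives are the limit of the same second difference quotient.\<close>

lemma pd_commute:
  fixes f :: "real^3 \<Rightarrow> real"
  assumes f: "\<And>x. f differentiable (at x)"
    and f1: "\<And>x. pd i f differentiable (at x)" "\<And>x. pd j f differentiable (at x)"
    and f2: "continuous_on UNIV (pd j (pd i f))" "continuous_on UNIV (pd i (pd j f))"
  shows "pd i (pd j f) x = pd j (pd i f) x"
proof (rule ccontr)
  let ?a = "pd i (pd j f)" and ?b = "pd j (pd i f)"
  assume ne: "?a x \<noteq> ?b x"
  define e where "e = \<bar>?a x - ?b x\<bar> / 2"
  have e: "e > 0" using ne by (simp add: e_def)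
  obtain d1 where d1: "d1 > 0" "\<And>y. dist y x < d1 \<Longrightarrow> dist (?a y) (?a x) < e"
    using f2(2) e unfolding continuous_on_iff by (metis UNIV_I)
  obtain d2 where d2: "d2 > 0" "\<And>y. dist y x < d2 \<Longrightarrow> dist (?b y) (?b x) < e"
    using f2(1) e unfolding continuous_on_iff by (metis UNIV_I)
  define h where "h = min d1 d2 / 2"
  have h: "h > 0" using d1 d2 by (simp add: h_def)
  have close: "dist (x + s *\<^sub>R axis k 1 + t *\<^sub>R axis l 1) x < min d1 d2"
    if "0 < s" "s < h" "0 < t" "t < h" for s t :: real and k l :: 3
  proof -
    have "norm (s *\<^sub>R axis k 1 + t *\<^sub>R axis l (1::real)) \<le> s + t"
      using that norm_triangle_ineq[of "s *\<^sub>R axis k (1::real)" "t *\<^sub>R axis l 1"] by simp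
    then show ?thesis
      using that by (simp add: dist_norm h_def add.assoc)
  qed
  obtain s t where st: "0 < s" "s < h" "0 < t" "t < h"
    "f (x + h *\<^sub>R axis i 1 + h *\<^sub>R axis j 1) - f (x + h *\<^sub>R axis i 1) - f (x + h *\<^sub>R axis j 1) + f x
      = h\<^sup>2 * ?b (x + s *\<^sub>R axis i 1 + t *\<^sub>R axis j 1)"
    using second_difference_mvt[OF f f1(1) h, of x j] by blast
  obtain s' t' where st': "0 < s'" "s' < h" "0 < t'" "t' < h"
    "f (x + h *\<^sub>R axis j 1 + h *\<^sub>R axis i 1) - f (x + h *\<^sub>R axis j 1) - f (x + h *\<^sub>R axis i 1) + f x
      = h\<^sup>2 * ?a (x + s' *\<^sub>R axis j 1 + t' *\<^sub>R axis i 1)"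
    using second_difference_mvt[OF f f1(2) h, of x i] by blast
  have "h\<^sup>2 * ?a (x + s' *\<^sub>R axis j 1 + t' *\<^sub>R axis i 1) = h\<^sup>2 * ?b (x + s *\<^sub>R axis i 1 + t *\<^sub>R axis j 1)"
    unfolding st(5)[symmetric] st'(5)[symmetric] by (simp add: algebra_simps)
  then have "?a (x + s' *\<^sub>R axis j 1 + t' *\<^sub>R axis i 1) = ?b (x + s *\<^sub>R axis i 1 + t *\<^sub>R axis j 1)"
    using h by simp
  moreover have "\<bar>?a (x + s' *\<^sub>R axis j 1 + t' *\<^sub>R axis i 1) - ?a x\<bar> < e"
    using d1(2) close[OF st'(1-4), of j i] by (simp add: dist_real_def)
  moreover have "\<bar>?b (x + s *\<^sub>R axis i 1 + t *\<^sub>R axis j 1) - ?b x\<bar> < e"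
    using d2(2) close[OF st(1-4), of i j] by (simp add: dist_real_def)
  ultimately show False
    unfolding e_def by (smt (verit) field_sum_of_halves)
qed

lemma torus_periodic_pd:
  assumes "torus_periodic f" "\<And>x. f differentiable (at x)"
  shows "torus_periodic (pd i f)"
  unfolding torus_periodic_def
proof (intro allI)
  fix x :: "real^3" and k
  have per: "(\<lambda>y. f (y + axis k 1)) = f"
    using assms(1) by (auto simp: torus_periodic_def)
  have "((\<lambda>y. y + axis k 1) has_derivative (\<lambda>h. h)) (at x)"
    by (auto intro!: derivative_eq_intros)
  from has_derivative_compose[OF this has_derivative_frechet[OF assms(2)]]
  have "(f has_derivative frechet_derivative f (at (x + axis k 1))) (at x)"
    using per by (simp add: o_def)
  from pd_eqI[OF this] show "pd i f (x + axis k 1) = pd i f x"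
    by (simp add: pd_def)
qed

section \<open>Integration over the torus\<close>

lemma torus_integrable:
  fixes f :: "real^3 \<Rightarrow> real"
  shows "continuous_on UNIV f \<Longrightarrow> f integrable_on cbox 0 One"
  by (meson continuous_on_subset integrable_continuous subset_UNIV)

lemma torus_integral_add:
  assumes "continuous_on UNIV f" "continuous_on UNIV g"
  shows "torus_integral (\<lambda>x. f x + g x) = torus_integral f + torus_integral g"
  unfolding torus_integral_def by (intro integral_add torus_integrable assms)

lemma torus_integral_diff:
  assumes "continuous_on UNIV f" "continuous_on UNIV g"
  shows "torus_integral (\<lambda>x. f x - g x) = torus_integral f - torus_integral g"
  unfolding torus_integral_def by (intro integral_diff torus_integrable assms)

lemma torus_integral_mult: "torus_integral (\<lambda>x. c * f x) = c * torus_integral f"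
  unfolding torus_integral_def by (rule integral_mult_right)

lemma torus_integral_continuous:
  fixes h :: "real \<Rightarrow> real^3 \<Rightarrow> real"
  assumes "continuous_on (S \<times> UNIV) (\<lambda>z. h (fst z) (snd z))"
  shows "continuous_on S (\<lambda>t. torus_integral (h t))"
  unfolding torus_integral_def
  by (rule integral_continuous_on_param) (auto simp: split_beta intro: continuous_on_subset[OF assms])

text \<open>Translation moves a slab out of the unit cube at one face, and by periodicity the slab that
  enters at the opposite face has the same integral.\<close>

lemma torus_integral_shift:
  fixes f :: "real^3 \<Rightarrow> real"
  assumes per: "torus_periodic f" and cont: "continuous_on UNIV f" and s: "0 \<le> s" "s \<le> 1"
  shows "torus_integral (\<lambda>x. f (x + s *\<^sub>R axis i 1)) = torus_integral f"
proof -
  let ?e = "axis i 1 :: real^3"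
  let ?c = "One + (s - 1) *\<^sub>R ?e"
  have intf: "f integrable_on cbox a b" for a b
    by (intro integrable_continuous continuous_on_subset[OF cont]) auto
  have e: "?e \<in> Basis" by simp
  have coords: "(\<Sum>b\<in>Basis. g b *\<^sub>R b) = v" if "\<And>b. b \<in> Basis \<Longrightarrow> g b = v \<bullet> b"
    for g and v :: "real^3"
    using that euclidean_representation[of v] by (metis (mono_tags, lifting) sum.cong)
  have [simp]: "?e \<bullet> b = (if b = ?e then 1 else 0)" "One \<bullet> b = 1" if "b \<in> Basis" for b
    using that e by (auto simp: inner_Basis)
  have boxes: "cbox 0 One \<inter> {x. x \<bullet> ?e \<le> s} = cbox 0 ?c"
    "cbox 0 One \<inter> {x. x \<bullet> ?e \<ge> s} = cbox (s *\<^sub>R ?e) One"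
    "cbox (s *\<^sub>R ?e) (One + s *\<^sub>R ?e) \<inter> {x. x \<bullet> ?e \<le> 1} = cbox (s *\<^sub>R ?e) One"
    "cbox (s *\<^sub>R ?e) (One + s *\<^sub>R ?e) \<inter> {x. x \<bullet> ?e \<ge> 1} = cbox ?e (One + s *\<^sub>R ?e)"
    unfolding interval_split[OF e] using s
    by (intro arg_cong2[where f=cbox] coords refl; simp add: e inner_add_left)+
  have "torus_integral (\<lambda>x. f (x + s *\<^sub>R ?e)) = integral (cbox (s *\<^sub>R ?e) (One + s *\<^sub>R ?e)) f"
    using integral_shift_cbox[of "s *\<^sub>R ?e" "s *\<^sub>R ?e" "One + s *\<^sub>R ?e" f]
    by (simp add: torus_integral_def)
  also have "\<dots> = integral (cbox (s *\<^sub>R ?e) One) f + integral (cbox ?e (One + s *\<^sub>R ?e)) f"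
    using integral_split[OF intf e, of "s *\<^sub>R ?e" "One + s *\<^sub>R ?e" 1] by (simp only: boxes)
  also have "integral (cbox ?e (One + s *\<^sub>R ?e)) f = integral (cbox 0 ?c) (\<lambda>x. f (x + ?e))"
    using integral_shift_cbox[of ?e ?e "One + s *\<^sub>R ?e" f] by (simp add: algebra_simps)
  also have "(\<lambda>x. f (x + ?e)) = f"
    using per by (auto simp: torus_periodic_def)
  also have "integral (cbox (s *\<^sub>R ?e) One) f + integral (cbox 0 ?c) f = torus_integral f"
    using integral_split[OF intf e, of 0 One s] by (simp only: boxes torus_integral_def add.commute)
  finally show ?thesis .
qed

text \<open>Differentiation under the integral sign, with one-sided time derivatives at the end points.\<close>

lemma torus_integral_leibniz:
  fixes f f' :: "real \<Rightarrow> real^3 \<Rightarrow> real"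
  assumes deriv: "\<And>t x. t \<in> {a..b} \<Longrightarrow> ((\<lambda>s. f s x) has_vector_derivative f' t x) (at t within {a..b})"
    and cont: "\<And>t. t \<in> {a..b} \<Longrightarrow> continuous_on UNIV (f t)"
    and cont': "continuous_on ({a..b} \<times> UNIV) (\<lambda>(t, x). f' t x)"
    and t: "t \<in> {a..b}"
  shows "((\<lambda>t. torus_integral (f t)) has_vector_derivative torus_integral (f' t)) (at t within {a..b})"
  unfolding torus_integral_def
proof (rule leibniz_rule_vector_derivative)
  show "continuous_on ({a..b} \<times> cbox 0 One) (\<lambda>(t, x). f' t x)"
    by (rule continuous_on_subset[OF cont']) auto
qed (use deriv t in \<open>auto intro!: integrable_continuous continuous_on_subset[OF cont]\<close>)

text \<open>By translation invariance the integral of \<open>x \<mapsto> f (x + s e\<^sub>i)\<close> does not depend on \<open>s\<close>; its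
  derivative in \<open>s\<close> at \<open>0\<close> is the integral of \<open>\<partial>\<^sub>i f\<close>.\<close>

lemma torus_integral_pd_eq_0:
  fixes f :: "real^3 \<Rightarrow> real"
  assumes per: "torus_periodic f" and f: "\<And>x. f differentiable (at x)"
    and cont: "continuous_on UNIV (pd i f)"
  shows "torus_integral (pd i f) = 0"
proof -
  let ?F = "\<lambda>s. torus_integral (\<lambda>x. f (x + s *\<^sub>R axis i 1))"
  have fc: "continuous_on UNIV f"
    using f by (simp add: continuous_on_eq_continuous_at differentiable_imp_continuous_within)
  have "(?F has_vector_derivative torus_integral (\<lambda>x. pd i f (x + 0 *\<^sub>R axis i 1))) (at 0 within {0..1})"
    by (rule torus_integral_leibniz)
       (auto intro!: has_vector_derivative_pd f continuous_on_compose2[OF fc]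
          continuous_on_compose2[OF cont] continuous_intros simp: split_beta)
  moreover have "(?F has_vector_derivative 0) (at 0 within {0..1})"
    by (rule has_vector_derivative_transform[OF _ _ has_vector_derivative_const[of "torus_integral f"]])
       (auto simp: torus_integral_shift[OF per fc])
  ultimately show ?thesis
    using vector_derivative_unique_within_closed_interval[of 0 1 0 ?F] by auto
qed

section \<open>Periodic functions of class \<open>C\<^sup>1\<close>\<close>

text \<open>The scalar fields at a fixed time that may appear in a flux: they are closed under the ring
  operations, and their partial derivatives integrate to zero.\<close>

definition C1_periodic :: "(real^3 \<Rightarrow> real) \<Rightarrow> bool" where
  "C1_periodic f \<longleftrightarrow> torus_periodic f \<and> (\<forall>x. f differentiable (at x)) \<and>
     (\<forall>i. continuous_on UNIV (pd i f))"

lemma C1_periodic_differentiable: "C1_periodic f \<Longrightarrow> f differentiable (at x)"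
  by (simp add: C1_periodic_def)

lemma C1_periodic_continuous: "C1_periodic f \<Longrightarrow> continuous_on S f"
  unfolding C1_periodic_def
  by (meson continuous_at_imp_continuous_on differentiable_imp_continuous_within)

lemma C1_periodic_continuous_pd: "C1_periodic f \<Longrightarrow> continuous_on S (pd i f)"
  unfolding C1_periodic_def by (meson continuous_on_subset subset_UNIV)

lemma C1_periodic_torus_periodic: "C1_periodic f \<Longrightarrow> torus_periodic f"
  by (simp add: C1_periodic_def)

lemma C1_periodic_pd_diff:
  "C1_periodic f \<Longrightarrow> C1_periodic g \<Longrightarrow> pd i (\<lambda>x. f x - g x) x = pd i f x - pd i g x"
  by (simp add: C1_periodic_def pd_diff)

lemma C1_periodic_pd_add:
  "C1_periodic f \<Longrightarrow> C1_periodic g \<Longrightarrow> pd i (\<lambda>x. f x + g x) x = pd i f x + pd i g x"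
  by (simp add: C1_periodic_def pd_add)

lemma C1_periodic_pd_mult:
  "C1_periodic f \<Longrightarrow> C1_periodic g \<Longrightarrow> pd i (\<lambda>x. f x * g x) x = f x * pd i g x + pd i f x * g x"
  by (simp add: C1_periodic_def pd_mult)

lemma C1_periodic_pd_sum:
  "(\<And>k. C1_periodic (f k)) \<Longrightarrow> pd i (\<lambda>x. \<Sum>k\<in>K. f k x) x = (\<Sum>k\<in>K. pd i (f k) x)"
  by (simp add: C1_periodic_def pd_sum)

lemma C1_periodic_const: "C1_periodic (\<lambda>x. c)"
  by (simp add: C1_periodic_def torus_periodic_def fun_eq_iff[of "pd _ _"] cong: continuous_on_cong)

lemma C1_periodic_add: "C1_periodic f \<Longrightarrow> C1_periodic g \<Longrightarrow> C1_periodic (\<lambda>x. f x + g x)"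
  by (subst C1_periodic_def)
     (auto simp: C1_periodic_pd_add torus_periodic_def C1_periodic_def[of f] C1_periodic_def[of g] pd_add
       intro!: continuous_intros cong: continuous_on_cong)

lemma C1_periodic_diff: "C1_periodic f \<Longrightarrow> C1_periodic g \<Longrightarrow> C1_periodic (\<lambda>x. f x - g x)"
  by (subst C1_periodic_def)
     (auto simp: torus_periodic_def C1_periodic_def[of f] C1_periodic_def[of g] pd_diff
       intro!: continuous_intros cong: continuous_on_cong)

lemma C1_periodic_mult:
  assumes f: "C1_periodic f" and g: "C1_periodic g"
  shows "C1_periodic (\<lambda>x. f x * g x)"
proof -
  have "continuous_on UNIV (\<lambda>x. pd i (\<lambda>x. f x * g x) x)" for i
    unfolding C1_periodic_pd_mult[OF f g]
    by (intro continuous_intros C1_periodic_continuous C1_periodic_continuous_pd f g)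
  then show ?thesis
    using f g by (auto simp: C1_periodic_def torus_periodic_def intro: differentiable_mult)
qed

lemma C1_periodic_sum:
  assumes f: "\<And>k. C1_periodic (f k)"
  shows "C1_periodic (\<lambda>x. \<Sum>k\<in>K. f k x)"
proof (induction K rule: infinite_finite_induct)
  case (insert k K)
  then show ?case using C1_periodic_add[OF f[of k] insert.IH] by simp
qed (simp_all add: C1_periodic_const)

lemma C1_periodic_pd_commute:
  assumes "C1_periodic f" "\<And>i. C1_periodic (pd i f)"
  shows "pd i (pd j f) x = pd j (pd i f) x"
  using assms by (intro pd_commute) (auto simp: C1_periodic_def)

text \<open>The derivative of \<open>h\<close> is taken within \<open>S\<close>, so that \<open>S\<close> may be a closed interval whose
  end points are values of \<open>f\<close>.\<close>

lemma C1_periodic_compose: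
  assumes f: "C1_periodic f" and S: "\<And>x. f x \<in> S"
    and h: "\<And>s. s \<in> S \<Longrightarrow> (h has_real_derivative h' s) (at s within S)"
    and h': "continuous_on S h'"
  shows "C1_periodic (\<lambda>x. h (f x))" and "pd i (\<lambda>x. h (f x)) x = h' (f x) * pd i f x"
proof -
  have der: "((\<lambda>x. h (f x)) has_derivative (\<lambda>v. h' (f x) * frechet_derivative f (at x) v)) (at x)" for x
  proof -
    have "(h has_derivative (*) (h' (f x))) (at (f x) within range f)"
      using has_field_derivative_imp_has_derivative[OF h[OF S]] S by (blast intro: has_derivative_subset)
    then show ?thesis
      using has_derivative_in_compose[OF has_derivative_frechet[OF C1_periodic_differentiable[OF f]]]
      by blast
  qed
  have pd: "pd i (\<lambda>x. h (f x)) x = h' (f x) * pd i f x" for i x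
    using pd_eqI[OF der] by (simp add: pd_def)
  then show "pd i (\<lambda>x. h (f x)) x = h' (f x) * pd i f x" .
  have "continuous_on UNIV (\<lambda>x. h' (f x) * pd i f x)" for i
    using S by (intro continuous_intros C1_periodic_continuous_pd f
        continuous_on_compose2[OF h' C1_periodic_continuous[OF f]]) auto
  then show "C1_periodic (\<lambda>x. h (f x))"
    using f der by (auto simp: C1_periodic_def torus_periodic_def pd differentiable_def
        cong: continuous_on_cong)
qed

lemmas C1_periodic_intros = C1_periodic_const C1_periodic_add C1_periodic_diff C1_periodic_mult
  C1_periodic_sum
lemmas C1_periodic_pd = C1_periodic_pd_add C1_periodic_pd_diff C1_periodic_pd_mult C1_periodic_pd_sum

lemma C1_periodic_pd_const_mult:
  "C1_periodic f \<Longrightarrow> pd i (\<lambda>x. c * f x) x = c * pd i f x"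
  using C1_periodic_pd_mult[OF C1_periodic_const] by simp

section \<open>Balance laws\<close>

text \<open>This replaces integration by parts: to compare two integrals, exhibit the flux \<open>F\<close>.\<close>

lemma torus_integral_divergence_eq:
  assumes F: "\<And>i. C1_periodic (F i)" and g: "continuous_on UNIV g"
    and eq: "\<And>x. f x = g x + (\<Sum>i\<in>UNIV. pd i (F i) x)"
  shows "torus_integral f = torus_integral g"
proof -
  have "integral (cbox 0 One) (\<lambda>x. \<Sum>i\<in>UNIV. pd i (F i) x) = (\<Sum>i\<in>UNIV. torus_integral (pd i (F i)))"
    unfolding torus_integral_def
    by (rule integral_sum) (auto intro!: torus_integrable C1_periodic_continuous_pd F)
  also have "\<dots> = 0"
    using F by (simp add: torus_integral_pd_eq_0 C1_periodic_def)
  finally show ?thesis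
    unfolding torus_integral_def eq
    by (subst integral_add) (auto intro!: torus_integrable g continuous_intros C1_periodic_continuous_pd F)
qed

text \<open>Formally this integrates \<open>g \<sqdot> \<nabla>\<partial>\<^sub>t \<psi>\<close> by parts, with \<open>vt i\<close> the time derivative of
  \<open>\<partial>\<^sub>i \<psi>\<close>. To avoid \<open>\<partial>\<^sub>i \<partial>\<^sub>t \<psi>\<close>, whose existence is not assumed, the integration by parts is
  carried out for \<open>\<psi>\<close> at every time \<open>s\<close> with the weight \<open>g\<close> held fixed, and the resulting identity is
  differentiated in \<open>s\<close>.\<close>

lemma torus_integral_time_derivative_gradient:
  fixes \<psi> \<psi>t :: "real \<Rightarrow> real^3 \<Rightarrow> real" and g :: "3 \<Rightarrow> real^3 \<Rightarrow> real"
  assumes ab: "a < b" and t: "t \<in> {a..b}"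
    and \<psi>: "\<And>s. s \<in> {a..b} \<Longrightarrow> C1_periodic (\<psi> s)" and g: "\<And>i. C1_periodic (g i)"
    and deriv: "\<And>s x. s \<in> {a..b} \<Longrightarrow> ((\<lambda>s. \<psi> s x) has_vector_derivative \<psi>t s x) (at s within {a..b})"
      "\<And>i s x. s \<in> {a..b} \<Longrightarrow> ((\<lambda>s. pd i (\<psi> s) x) has_vector_derivative vt i s x) (at s within {a..b})"
    and cont: "continuous_on ({a..b} \<times> UNIV) (\<lambda>z. \<psi>t (fst z) (snd z))"
      "\<And>i. continuous_on ({a..b} \<times> UNIV) (\<lambda>z. vt i (fst z) (snd z))"
  shows "torus_integral (\<lambda>x. (\<Sum>i\<in>UNIV. g i x * vt i t x) + (\<Sum>i\<in>UNIV. pd i (g i) x) * \<psi>t t x) = 0"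
proof -
  let ?h = "\<lambda>s x. (\<Sum>i\<in>UNIV. g i x * pd i (\<psi> s) x) + (\<Sum>i\<in>UNIV. pd i (g i) x) * \<psi> s x"
  let ?h' = "\<lambda>s x. (\<Sum>i\<in>UNIV. g i x * vt i s x) + (\<Sum>i\<in>UNIV. pd i (g i) x) * \<psi>t s x"
  have zero: "torus_integral (?h s) = 0" if s: "s \<in> {a..b}" for s
  proof -
    have "torus_integral (?h s) = torus_integral (\<lambda>x. 0)"
    proof (rule torus_integral_divergence_eq[where F="\<lambda>i x. g i x * \<psi> s x"])
      show "?h s x = 0 + (\<Sum>i\<in>UNIV. pd i (\<lambda>x. g i x * \<psi> s x) x)" for x
        by (simp add: C1_periodic_pd_mult g \<psi>[OF s] sum.distrib sum_distrib_right)
    qed (auto intro!: C1_periodic_mult g \<psi> s)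
    then show ?thesis by (simp add: torus_integral_def)
  qed
  have "((\<lambda>s. torus_integral (?h s)) has_vector_derivative torus_integral (?h' t)) (at t within {a..b})"
  proof (rule torus_integral_leibniz)
    have gc: "continuous_on ({a..b} \<times> UNIV) (\<lambda>z. g i (snd z))"
      "continuous_on ({a..b} \<times> UNIV) (\<lambda>z. pd i (g i) (snd z))" for i
      by (auto intro!: continuous_on_compose2[OF C1_periodic_continuous[OF g, of UNIV]]
          continuous_on_compose2[OF C1_periodic_continuous_pd[OF g, of UNIV]] continuous_intros)
    show "continuous_on ({a..b} \<times> UNIV) (\<lambda>(t, x). ?h' t x)"
      unfolding split_beta by (intro continuous_intros gc cont)
    show "((\<lambda>s. ?h s x) has_vector_derivative ?h' s x) (at s within {a..b})" if "s \<in> {a..b}" for s x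
      using that by (intro has_vector_derivative_add has_vector_derivative_sum
          has_vector_derivative_mult_right deriv)
    show "continuous_on UNIV (?h s)" if "s \<in> {a..b}" for s
      by (intro continuous_intros C1_periodic_continuous C1_periodic_continuous_pd g \<psi> that)
  qed (rule t)
  moreover have "((\<lambda>s. torus_integral (?h s)) has_vector_derivative 0) (at t within {a..b})"
    by (rule has_vector_derivative_transform[OF t _ has_vector_derivative_const]) (simp add: zero)
  ultimately show ?thesis
    by (rule vector_derivative_unique_within_closed_interval[of a b t, unfolded box_real, OF ab t])
qed

text \<open>The rate of the kinetic energy at a fixed time, for a divergence-free \<open>w\<close> transported by the
  mass flux \<open>\<rho> u\<close> and driven by a stress \<open>S\<close>. Here \<open>a\<close> stands for \<open>\<partial>\<^sub>t \<rho>\<close> and \<open>f j\<close> for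
  \<open>\<partial>\<^sub>t (\<rho> w\<^sub>j)\<close>, so the integrand on the left is the time derivative of \<open>\<rho> |w|\<^sup>2 / 2\<close>.\<close>

lemma kinetic_energy_balance:
  fixes w u f :: "3 \<Rightarrow> real^3 \<Rightarrow> real" and S :: "3 \<Rightarrow> 3 \<Rightarrow> real^3 \<Rightarrow> real"
  assumes C1: "C1_periodic \<rho>" "C1_periodic p" "\<And>j. C1_periodic (w j)" "\<And>j. C1_periodic (u j)"
      "\<And>i j. C1_periodic (S i j)"
    and mass: "\<And>x. a x + (\<Sum>i\<in>UNIV. pd i (\<lambda>y. \<rho> y * u i y) x) = 0"
    and mom: "\<And>j x. f j x + (\<Sum>i\<in>UNIV. pd i (\<lambda>y. \<rho> y * u i y * w j y) x)
        - (\<Sum>i\<in>UNIV. pd i (S i j) x) + pd j p x = 0"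
    and div: "\<And>x. (\<Sum>i\<in>UNIV. pd i (w i) x) = 0"
  shows "torus_integral (\<lambda>x. (\<Sum>j\<in>UNIV. w j x * f j x) - a x * (\<Sum>j\<in>UNIV. w j x * w j x) / 2)
    = torus_integral (\<lambda>x. - (\<Sum>i\<in>UNIV. \<Sum>j\<in>UNIV. S i j x * pd i (w j) x))"
proof (rule torus_integral_divergence_eq)
  \<comment> \<open>the flux of work done by the stress and the pressure, less the convected kinetic energy\<close>
  define F where "F i x = (\<Sum>j\<in>UNIV. S i j x * w j x) - p x * w i x
      - (1/2) * (\<rho> x * u i x) * (\<Sum>j\<in>UNIV. w j x * w j x)" for i x
  show "C1_periodic (F i)" for i
    unfolding F_def by (intro C1_periodic_intros C1)
  show "continuous_on UNIV (\<lambda>x. - (\<Sum>i\<in>UNIV. \<Sum>j\<in>UNIV. S i j x * pd i (w j) x))"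
    by (intro continuous_intros C1_periodic_continuous C1_periodic_continuous_pd C1)
  fix x
  have dF: "pd i (F i) x = (\<Sum>j\<in>UNIV. S i j x * pd i (w j) x + pd i (S i j) x * w j x)
      - (p x * pd i (w i) x + pd i p x * w i x)
      - (1/2) * (\<rho> x * u i x * (\<Sum>j\<in>UNIV. w j x * pd i (w j) x + pd i (w j) x * w j x)
         + pd i (\<lambda>y. \<rho> y * u i y) x * (\<Sum>j\<in>UNIV. w j x * w j x))" for i
    unfolding F_def
    by (simp only: C1_periodic_pd C1_periodic_intros C1 pd_const) (simp add: add_divide_distrib)
  have fj: "f j x = (\<Sum>i\<in>UNIV. pd i (S i j) x) - pd j p x
      - (\<Sum>i\<in>UNIV. \<rho> x * u i x * pd i (w j) x + pd i (\<lambda>y. \<rho> y * u i y) x * w j x)" for j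
    using mom[of j x] by (simp add: C1_periodic_pd_mult C1_periodic_intros C1)
  have a: "a x = - (\<Sum>i\<in>UNIV. pd i (\<lambda>y. \<rho> y * u i y) x)"
    using mass[of x] by simp
  have d: "pd 3 (w 3) x = - pd 1 (w 1) x - pd 2 (w 2) x"
    using div[of x] by (simp add: sum_3)
  show "(\<Sum>j\<in>UNIV. w j x * f j x) - a x * (\<Sum>j\<in>UNIV. w j x * w j x) / 2
    = - (\<Sum>i\<in>UNIV. \<Sum>j\<in>UNIV. S i j x * pd i (w j) x) + (\<Sum>i\<in>UNIV. pd i (F i) x)"
    unfolding dF fj a by (simp add: sum_3 d field_simps)
qed

text \<open>The rate of the energy \<open>\<rho> |\<nabla>\<psi>|\<^sup>2 / 2\<close> at a fixed time. Here \<open>a\<close> and \<open>b\<close> stand for \<open>\<partial>\<^sub>t \<rho>\<close> and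
  \<open>\<partial>\<^sub>t \<psi>\<close>, and \<open>q\<close> for \<open>\<mu>'(\<rho>)\<close>, which is only continuous. By
  \<open>torus_integral_time_derivative_gradient\<close> with weight \<open>\<rho> \<nabla>\<psi>\<close>, the left-hand side is the
  integral of the time derivative of the energy. The terms that contain second derivatives of \<open>u\<close>
  cancel because those derivatives commute.\<close>

lemma drift_energy_balance:
  fixes u :: "3 \<Rightarrow> real^3 \<Rightarrow> real"
  assumes C1: "C1_periodic \<rho>" "C1_periodic m" "\<And>j. C1_periodic (u j)" "\<And>i j. C1_periodic (pd i (u j))"
      "\<And>i. C1_periodic (pd i \<psi>)" "\<And>i j. C1_periodic (pd j (pd i \<psi>))" "C1_periodic \<psi>"
    and q: "continuous_on UNIV q"
    and m: "\<And>i x. pd i m x = \<rho> x * pd i \<psi> x" "\<And>i x. q x * pd i \<rho> x = \<rho> x * pd i \<psi> x"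
    and mass: "\<And>x. a x + (\<Sum>i\<in>UNIV. pd i (\<lambda>y. \<rho> y * u i y) x) = 0"
    and b: "\<And>x. b x + (\<Sum>i\<in>UNIV. u i x * pd i \<psi> x) + q x * (\<Sum>i\<in>UNIV. pd i (u i) x) = 0"
  shows "torus_integral (\<lambda>x. a x * (\<Sum>i\<in>UNIV. pd i \<psi> x * pd i \<psi> x) / 2
        - (\<Sum>i\<in>UNIV. pd i (\<lambda>y. \<rho> y * pd i \<psi> y) x) * b x)
    = torus_integral (\<lambda>x. m x * ((\<Sum>i\<in>UNIV. \<Sum>j\<in>UNIV. pd i (pd j \<psi>) x * pd i (u j) x)
        - (\<Sum>i\<in>UNIV. pd i (pd i \<psi>) x) * (\<Sum>i\<in>UNIV. pd i (u i) x))
        + q x * \<rho> x * (\<Sum>i\<in>UNIV. pd i (pd i \<psi>) x) * (\<Sum>i\<in>UNIV. pd i (u i) x))"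
    (is "_ = torus_integral ?g")
proof (rule torus_integral_divergence_eq)
  \<comment> \<open>The first term integrates \<open>div(\<rho> v) (u \<sqdot> v)\<close> by parts, the second is the convected energy, and
    the third moves the derivative off \<open>m\<close> in \<open>\<partial>\<^sub>i m (v \<sqdot> \<nabla>u\<^sub>i - v\<^sub>i div u)\<close>.\<close>
  define F where "F i x = \<rho> x * pd i \<psi> x * (\<Sum>j\<in>UNIV. u j x * pd j \<psi> x)
      - (1/2) * (\<rho> x * u i x) * (\<Sum>j\<in>UNIV. pd j \<psi> x * pd j \<psi> x)
      - m x * ((\<Sum>j\<in>UNIV. pd j \<psi> x * pd j (u i) x) - pd i \<psi> x * (\<Sum>j\<in>UNIV. pd j (u j) x))" for i x
  show "C1_periodic (F i)" for i
    unfolding F_def by (intro C1_periodic_intros C1)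
  show "continuous_on UNIV ?g"
    by (intro continuous_intros C1_periodic_continuous C1_periodic_continuous_pd C1 q)
  fix x
  have symm: "pd i (pd j \<psi>) x = pd j (pd i \<psi>) x" "pd i (pd j (u k)) x = pd j (pd i (u k)) x" for i j k
    by (intro C1_periodic_pd_commute C1)+
  have sym\<psi>: "pd 2 (pd 1 \<psi>) x = pd 1 (pd 2 \<psi>) x" "pd 3 (pd 1 \<psi>) x = pd 1 (pd 3 \<psi>) x"
     "pd 3 (pd 2 \<psi>) x = pd 2 (pd 3 \<psi>) x" by (rule symm)+
  have symu: "pd 2 (pd 1 (u k)) x = pd 1 (pd 2 (u k)) x" "pd 3 (pd 1 (u k)) x = pd 1 (pd 3 (u k)) x"
     "pd 3 (pd 2 (u k)) x = pd 2 (pd 3 (u k)) x" for k by (rule symm)+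
  have dF: "pd i (F i) x = \<rho> x * pd i \<psi> x * (\<Sum>j\<in>UNIV. u j x * pd i (pd j \<psi>) x + pd i (u j) x * pd j \<psi> x)
      + pd i (\<lambda>y. \<rho> y * pd i \<psi> y) x * (\<Sum>j\<in>UNIV. u j x * pd j \<psi> x)
      - (1/2) * (\<rho> x * u i x * (\<Sum>j\<in>UNIV. pd j \<psi> x * pd i (pd j \<psi>) x + pd i (pd j \<psi>) x * pd j \<psi> x)
         + pd i (\<lambda>y. \<rho> y * u i y) x * (\<Sum>j\<in>UNIV. pd j \<psi> x * pd j \<psi> x))
      - (m x * ((\<Sum>j\<in>UNIV. pd j \<psi> x * pd i (pd j (u i)) x + pd i (pd j \<psi>) x * pd j (u i) x)
          - (pd i \<psi> x * (\<Sum>j\<in>UNIV. pd i (pd j (u j)) x) + pd i (pd i \<psi>) x * (\<Sum>j\<in>UNIV. pd j (u j) x)))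
        + \<rho> x * pd i \<psi> x * ((\<Sum>j\<in>UNIV. pd j \<psi> x * pd j (u i) x) - pd i \<psi> x * (\<Sum>j\<in>UNIV. pd j (u j) x)))" for i
    unfolding F_def
    by (simp only: C1_periodic_pd C1_periodic_intros C1 pd_const) (simp add: m(1) add_divide_distrib)
  have a: "a x = - (\<Sum>i\<in>UNIV. pd i (\<lambda>y. \<rho> y * u i y) x)"
    using mass[of x] by simp
  have b': "b x = - (\<Sum>i\<in>UNIV. u i x * pd i \<psi> x) - q x * (\<Sum>i\<in>UNIV. pd i (u i) x)"
    using b[of x] by simp
  \<comment> \<open>The product with \<open>q\<close> is expanded pointwise, so \<open>q\<close> is never differentiated.\<close>
  have qdiv: "q x * (\<Sum>i\<in>UNIV. pd i (\<lambda>y. \<rho> y * pd i \<psi> y) x)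
    = q x * \<rho> x * (\<Sum>i\<in>UNIV. pd i (pd i \<psi>) x) + (\<Sum>i\<in>UNIV. \<rho> x * pd i \<psi> x * pd i \<psi> x)"
  proof -
    have eq: "\<rho> x * pd i \<psi> x * pd i \<psi> x = q x * (pd i \<rho> x * pd i \<psi> x)" for i
      by (simp add: m(2)[symmetric] mult.assoc)
    show ?thesis
      unfolding eq by (simp add: C1_periodic_pd_mult C1 sum.distrib sum_distrib_left distrib_left mult_ac)
  qed
  define D where "D = (\<Sum>i\<in>UNIV. pd i (\<lambda>y. \<rho> y * pd i \<psi> y) x)"
  have D: "(\<Sum>i\<in>UNIV. pd i (\<lambda>y. \<rho> y * pd i \<psi> y) x * c) = D * c" for c
    by (simp add: D_def sum_distrib_right)
  let ?div = "\<Sum>i\<in>UNIV. pd i (u i) x"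
  have "a x * (\<Sum>i\<in>UNIV. pd i \<psi> x * pd i \<psi> x) / 2 - D * b x
    = a x * (\<Sum>i\<in>UNIV. pd i \<psi> x * pd i \<psi> x) / 2 + D * (\<Sum>i\<in>UNIV. u i x * pd i \<psi> x) + (q x * D) * ?div"
    unfolding b' by (simp add: algebra_simps)
  also have "\<dots> = ?g x + (\<Sum>i\<in>UNIV. pd i (F i) x)"
    unfolding D_def qdiv
    unfolding dF a sum_3 sym\<psi> symu by (simp add: field_simps)
  finally show "a x * (\<Sum>i\<in>UNIV. pd i \<psi> x * pd i \<psi> x) / 2
        - (\<Sum>i\<in>UNIV. pd i (\<lambda>y. \<rho> y * pd i \<psi> y) x) * b x = ?g x + (\<Sum>i\<in>UNIV. pd i (F i) x)"
    unfolding D_def .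
qed

text \<open>Completing the square. \<open>G\<close>, \<open>V\<close> and \<open>U\<close> are the gradients of \<open>w\<close>, \<open>\<nabla>\<psi>\<close> and \<open>u\<close> at one
  point, \<open>L\<close> is \<open>\<Delta>\<psi>\<close> and \<open>n\<close> is \<open>\<mu>'(\<rho>) \<rho>\<close>. The symmetric part \<open>D\<close> of \<open>G\<close> enters through
  \<open>|D - 2\<kappa>V|\<^sup>2\<close> and the skew part only through its own square. Since \<open>tr U = - 2\<kappa>L\<close>, adding
  \<open>2\<kappa>L/3\<close> times the identity makes the symmetric part of \<open>U\<close> trace free and lowers its square by
  \<open>4\<kappa>\<^sup>2L\<^sup>2/3\<close>; with the coefficient \<open>(1 - 3)/3\<close> of \<open>m\<close> this adds up to \<open>- 4\<kappa>\<^sup>2L\<^sup>2m\<close>, which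
  balances the term \<open>m L tr U\<close>.\<close>

lemma dissipation_identity:
  fixes G V :: "3 \<Rightarrow> 3 \<Rightarrow> real"
  assumes tr: "(\<Sum>i\<in>UNIV. G i i) = 0" and sym: "\<And>i j. V i j = V j i"
    and U: "\<And>i j. U i j = G i j - 2 * \<kappa> * V i j" and L: "L = (\<Sum>i\<in>UNIV. V i i)"
  shows "(\<Sum>i\<in>UNIV. \<Sum>j\<in>UNIV. (m * (U i j + U j i) - 2 * \<kappa> * m * U j i) * G i j)
      - 4 * \<kappa> * (1 - \<kappa>) * (m * ((\<Sum>i\<in>UNIV. \<Sum>j\<in>UNIV. V i j * U i j) - L * (\<Sum>i\<in>UNIV. U i i))
            + n * L * (\<Sum>i\<in>UNIV. U i i))
    = 2 * \<kappa> * (m * (\<Sum>i\<in>UNIV. \<Sum>j\<in>UNIV. ((G i j - G j i) / 2)\<^sup>2))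
      + 2 * (1 - \<kappa>) * (m * (\<Sum>i\<in>UNIV. \<Sum>j\<in>UNIV. ((U i j + U j i) / 2 + 2 * \<kappa> / 3 * L * (if i = j then 1 else 0))\<^sup>2))
      + 2 * (1 - \<kappa>) * (((1 - 3) / 3 * m + n) * (2 * \<kappa> * L)\<^sup>2)"
proof -
  have [simp]: "V 2 1 = V 1 2" "V 3 1 = V 1 3" "V 3 2 = V 2 3" by (rule sym)+
  have [simp]: "G 3 3 = - G 1 1 - G 2 2"
    using tr by (simp add: sum_3)
  show ?thesis
    unfolding U L sum_3 by (simp add: field_simps power2_eq_square)
qed

text \<open>The combination of the two balance laws in which the cross terms between \<open>w\<close> and \<open>\<nabla>\<psi>\<close>
  assemble to a square.\<close>

lemma energy_dissipation_rate:
  fixes w :: "3 \<Rightarrow> real^3 \<Rightarrow> real" and \<psi> \<rho> :: "real^3 \<Rightarrow> real" and \<kappa> :: real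
  defines "u \<equiv> \<lambda>j x. w j x - 2 * \<kappa> * pd j \<psi> x"
    and "L \<equiv> \<lambda>x. \<Sum>i\<in>UNIV. pd i (pd i \<psi>) x"
  assumes C1: "C1_periodic \<rho>" "C1_periodic m" "C1_periodic p" "C1_periodic \<psi>"
      "\<And>j. C1_periodic (w j)" "\<And>i j. C1_periodic (pd i (w j))"
      "\<And>i. C1_periodic (pd i \<psi>)" "\<And>i j. C1_periodic (pd j (pd i \<psi>))"
    and q: "continuous_on UNIV q"
    and m: "\<And>i x. pd i m x = \<rho> x * pd i \<psi> x" "\<And>i x. q x * pd i \<rho> x = \<rho> x * pd i \<psi> x"
    and mass: "\<And>x. a x + (\<Sum>i\<in>UNIV. pd i (\<lambda>y. \<rho> y * u i y) x) = 0"
    and b: "\<And>x. b x + (\<Sum>i\<in>UNIV. u i x * pd i \<psi> x) + q x * (\<Sum>i\<in>UNIV. pd i (u i) x) = 0"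
    and mom: "\<And>j x. f j x + (\<Sum>i\<in>UNIV. pd i (\<lambda>y. \<rho> y * u i y * w j y) x)
        - (\<Sum>i\<in>UNIV. pd i (\<lambda>y. m y * (pd i (u j) y + pd j (u i) y) - 2 * \<kappa> * m y * pd j (u i) y) x)
        + pd j p x = 0"
    and div: "\<And>x. (\<Sum>i\<in>UNIV. pd i (w i) x) = 0"
  shows "torus_integral (\<lambda>x. (\<Sum>j\<in>UNIV. w j x * f j x) - a x * (\<Sum>j\<in>UNIV. w j x * w j x) / 2)
      + 4 * \<kappa> * (1 - \<kappa>) * torus_integral (\<lambda>x. a x * (\<Sum>i\<in>UNIV. pd i \<psi> x * pd i \<psi> x) / 2
        - (\<Sum>i\<in>UNIV. pd i (\<lambda>y. \<rho> y * pd i \<psi> y) x) * b x)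
    = - (2 * \<kappa> * torus_integral (\<lambda>x. m x * (\<Sum>i\<in>UNIV. \<Sum>j\<in>UNIV. ((pd i (w j) x - pd j (w i) x) / 2)\<^sup>2))
      + 2 * (1 - \<kappa>) * torus_integral (\<lambda>x. m x * (\<Sum>i\<in>UNIV. \<Sum>j\<in>UNIV.
            ((pd i (u j) x + pd j (u i) x) / 2 + 2 * \<kappa> / 3 * L x * (if i = j then 1 else 0))\<^sup>2))
      + 2 * (1 - \<kappa>) * torus_integral (\<lambda>x. ((1 - 3) / 3 * m x + q x * \<rho> x) * (2 * \<kappa> * L x)\<^sup>2))"
proof -
  have u: "C1_periodic (u j)" for j
    unfolding u_def by (intro C1_periodic_intros C1)
  have pdu: "pd i (u j) = (\<lambda>x. pd i (w j) x - 2 * \<kappa> * pd i (pd j \<psi>) x)" for i j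
    unfolding u_def by (rule ext) (simp add: C1_periodic_pd_diff C1_periodic_pd_const_mult C1_periodic_intros C1)
  have u2: "C1_periodic (pd i (u j))" for i j
    unfolding pdu by (intro C1_periodic_intros C1)
  have atoms: "continuous_on UNIV \<rho>" "continuous_on UNIV m" "continuous_on UNIV (pd i (u j))"
      "continuous_on UNIV (pd i (w j))" "continuous_on UNIV (pd i (pd j \<psi>))" "continuous_on UNIV L" for i j
    unfolding L_def by (intro continuous_intros C1_periodic_continuous C1_periodic_continuous_pd C1 u)+
  have S: "C1_periodic (\<lambda>x. m x * (pd i (u j) x + pd j (u i) x) - 2 * \<kappa> * m x * pd j (u i) x)" for i j
    by (intro C1_periodic_intros C1 u2)
  have W: "torus_integral (\<lambda>x. (\<Sum>j\<in>UNIV. w j x * f j x) - a x * (\<Sum>j\<in>UNIV. w j x * w j x) / 2)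
    = torus_integral (\<lambda>x. - (\<Sum>i\<in>UNIV. \<Sum>j\<in>UNIV.
        (m x * (pd i (u j) x + pd j (u i) x) - 2 * \<kappa> * m x * pd j (u i) x) * pd i (w j) x))"
    by (rule kinetic_energy_balance[OF C1(1,3,5) u S mass mom div])
  have K: "torus_integral (\<lambda>x. a x * (\<Sum>i\<in>UNIV. pd i \<psi> x * pd i \<psi> x) / 2
        - (\<Sum>i\<in>UNIV. pd i (\<lambda>y. \<rho> y * pd i \<psi> y) x) * b x)
    = torus_integral (\<lambda>x. m x * ((\<Sum>i\<in>UNIV. \<Sum>j\<in>UNIV. pd i (pd j \<psi>) x * pd i (u j) x)
        - L x * (\<Sum>i\<in>UNIV. pd i (u i) x)) + q x * \<rho> x * L x * (\<Sum>i\<in>UNIV. pd i (u i) x))"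
    unfolding L_def by (rule drift_energy_balance[OF C1(1,2) u u2 C1(7,8,4) q m mass b])
  define A B Q1 Q2 Q3 where
    "A x = (\<Sum>i\<in>UNIV. \<Sum>j\<in>UNIV.
        (m x * (pd i (u j) x + pd j (u i) x) - 2 * \<kappa> * m x * pd j (u i) x) * pd i (w j) x)" and
    "B x = m x * ((\<Sum>i\<in>UNIV. \<Sum>j\<in>UNIV. pd i (pd j \<psi>) x * pd i (u j) x)
        - L x * (\<Sum>i\<in>UNIV. pd i (u i) x)) + q x * \<rho> x * L x * (\<Sum>i\<in>UNIV. pd i (u i) x)" and
    "Q1 x = m x * (\<Sum>i\<in>UNIV. \<Sum>j\<in>UNIV. ((pd i (w j) x - pd j (w i) x) / 2)\<^sup>2)" and
    "Q2 x = m x * (\<Sum>i\<in>UNIV. \<Sum>j\<in>UNIV.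
            ((pd i (u j) x + pd j (u i) x) / 2 + 2 * \<kappa> / 3 * L x * (if i = j then 1 else 0))\<^sup>2)" and
    "Q3 x = ((1 - 3) / 3 * m x + q x * \<rho> x) * (2 * \<kappa> * L x)\<^sup>2" for x
  have pointwise: "A x - 4 * \<kappa> * (1 - \<kappa>) * B x
      = 2 * \<kappa> * Q1 x + 2 * (1 - \<kappa>) * Q2 x + 2 * (1 - \<kappa>) * Q3 x" for x
    unfolding A_def B_def Q1_def Q2_def Q3_def
    by (rule dissipation_identity[where G="\<lambda>i j. pd i (w j) x" and V="\<lambda>i j. pd i (pd j \<psi>) x"
        and U="\<lambda>i j. pd i (u j) x"])
      (simp_all add: div pdu L_def C1_periodic_pd_commute[OF C1(4,7)])
  have Qc: "continuous_on UNIV A" "continuous_on UNIV B" "continuous_on UNIV Q1"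
    "continuous_on UNIV Q2" "continuous_on UNIV Q3"
    unfolding A_def B_def Q1_def Q2_def Q3_def by (intro continuous_intros atoms q; simp)+
  have "torus_integral A - 4 * \<kappa> * (1 - \<kappa>) * torus_integral B
      = torus_integral (\<lambda>x. A x - 4 * \<kappa> * (1 - \<kappa>) * B x)"
    by (subst torus_integral_diff) (auto intro!: continuous_intros Qc simp: torus_integral_mult)
  also have "\<dots> = 2 * \<kappa> * torus_integral Q1 + 2 * (1 - \<kappa>) * torus_integral Q2
      + 2 * (1 - \<kappa>) * torus_integral Q3"
    unfolding pointwise
    by (subst torus_integral_add, (intro continuous_intros Qc)+)+ (simp add: torus_integral_mult)
  finally show ?thesis
    using torus_integral_mult[of "-1" A]
    unfolding W K A_def[symmetric] B_def[symmetric] Q1_def[symmetric] Q2_def[symmetric] Q3_def[symmetric]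
    by simp
qed

section \<open>Fields on the space-time slab\<close>

text \<open>Only the times in \<open>[0,T]\<close> matter. This is needed because taking a component commutes with
  \<open>pd\<close> only where the field is differentiable, which is known for those times alone.\<close>

lemma C1_space_cong:
  assumes "\<And>t. t \<in> {0..T} \<Longrightarrow> f t = g t"
  shows "C1_space T f = C1_space T g"
proof -
  have "continuous_on ({0..T} \<times> UNIV) (\<lambda>(t, x). f t x) = continuous_on ({0..T} \<times> UNIV) (\<lambda>(t, x). g t x)"
    "continuous_on ({0..T} \<times> UNIV) (\<lambda>(t, x). pd i (f t) x)
      = continuous_on ({0..T} \<times> UNIV) (\<lambda>(t, x). pd i (g t) x)" for i
    using assms by (intro continuous_on_cong; force)+
  then show ?thesis
    using assms by (simp add: C1_space_def)
qed

lemma C1_space_component: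
  assumes "C1_space T f"
  shows "C1_space T (\<lambda>t x. f t x $ j)"
    and "t \<in> {0..T} \<Longrightarrow> pd i (\<lambda>y. f t y $ j) x = pd i (f t) x $ j"
proof -
  have diff: "f t differentiable (at x)" if "t \<in> {0..T}" for t x
    using assms that by (simp add: C1_space_def)
  have pd: "pd i (\<lambda>y. f t y $ j) x = pd i (f t) x $ j" if "t \<in> {0..T}" for t x i
    by (rule pd_linear[OF bounded_linear_vec_nth diff[OF that]])
  then show "t \<in> {0..T} \<Longrightarrow> pd i (\<lambda>y. f t y $ j) x = pd i (f t) x $ j" .
  have "(\<lambda>y. f t y $ j) differentiable (at x)" if "t \<in> {0..T}" for t x
    using bounded_linear.has_derivative[OF bounded_linear_vec_nth has_derivative_frechet[OF diff[OF that]]]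
    by (auto simp: differentiable_def)
  moreover have "continuous_on ({0..T} \<times> UNIV) (\<lambda>(t, x). pd i (\<lambda>y. f t y $ j) x)" for i
  proof -
    have "continuous_on ({0..T} \<times> UNIV) (\<lambda>z. (\<lambda>(t, x). pd i (f t) x) z $ j)"
      using assms by (intro continuous_intros) (simp add: C1_space_def)
    then show ?thesis
      by (rule continuous_on_eq) (auto simp: pd)
  qed
  moreover have "continuous_on ({0..T} \<times> UNIV) (\<lambda>z. (\<lambda>(t, x). f t x) z $ j)"
    using assms by (intro continuous_intros) (simp add: C1_space_def)
  ultimately show "C1_space T (\<lambda>t x. f t x $ j)"
    by (auto simp: C1_space_def split_beta)
qed

lemma C1_space_slice:
  assumes "C1_space T f" "t \<in> {0..T}" "torus_periodic (f t)"
  shows "C1_periodic (f t)"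
proof -
  have "continuous_on UNIV (\<lambda>x. (\<lambda>(t, x). pd i (f t) x) (t, x))" for i
    by (rule continuous_on_compose2[where s=UNIV and t="{0..T} \<times> UNIV"])
       (use assms in \<open>auto simp: C1_space_def intro!: continuous_intros\<close>)
  then show ?thesis
    using assms by (simp add: C1_space_def C1_periodic_def)
qed

lemma C1_space_continuous:
  assumes "C1_space T f"
  shows "continuous_on ({0..T} \<times> UNIV) (\<lambda>z. f (fst z) (snd z))"
    and "continuous_on ({0..T} \<times> UNIV) (\<lambda>z. pd i (f (fst z)) (snd z))"
  using assms by (simp_all add: C1_space_def split_beta)

lemma C1_slab_has_vector_derivative_dt:
  "C1_slab T f \<Longrightarrow> t \<in> {0..T} \<Longrightarrow> ((\<lambda>s. f s x) has_vector_derivative dt T f t x) (at t within {0..T})"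
  by (simp add: C1_slab_def dt_def vector_derivative_works)

lemma dt_eqI:
  "T > 0 \<Longrightarrow> t \<in> {0..T} \<Longrightarrow> ((\<lambda>s. f s x) has_vector_derivative f') (at t within {0..T}) \<Longrightarrow> dt T f t x = f'"
  unfolding dt_def using vector_derivative_within_cbox[of 0 T t "\<lambda>s. f s x" f'] by simp

lemma C1_slab_continuous_dt:
  "C1_slab T f \<Longrightarrow> continuous_on ({0..T} \<times> UNIV) (\<lambda>z. dt T f (fst z) (snd z))"
  by (simp add: C1_slab_def split_beta)

lemma continuous_on_slice:
  assumes "continuous_on (S \<times> UNIV) (\<lambda>z. h (fst z) (snd z))" "t \<in> S"
  shows "continuous_on UNIV (h t)"
proof -
  have "continuous_on UNIV (Pair t)"
    by (intro continuous_intros)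
  then show ?thesis
    using continuous_on_compose2[OF assms(1), of UNIV "Pair t"] assms(2) by (simp add: image_subset_iff)
qed

lemma norm_matrix_power2:
  fixes M :: "real^'n^'m"
  shows "(norm M)\<^sup>2 = (\<Sum>i\<in>UNIV. \<Sum>j\<in>UNIV. (M $ i $ j)\<^sup>2)"
  by (simp add: power2_norm_eq_inner inner_vec_def) (simp add: power2_eq_square)

section \<open>The energy estimate\<close>

theorem proposition1:
  fixes T \<kappa> r R c d :: real
    and \<mu> \<mu>' \<phi> lam :: "real \<Rightarrow> real"
    and \<rho> \<psi> \<pi> \<pi>\<^sub>1 :: "real \<Rightarrow> real^3 \<Rightarrow> real"
    and u w :: "real \<Rightarrow> real^3 \<Rightarrow> real^3"
  assumes d: "d = 3"
    and T: "T > 0"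
    and kappa: "0 < \<kappa>" "\<kappa> < 1"
    and rR: "0 < r" "r \<le> R"
    and mu_deriv: "\<And>s. s \<in> {r..R} \<Longrightarrow> (\<mu> has_real_derivative \<mu>' s) (at s within {r..R})"
    and mu_C1: "continuous_on {r..R} \<mu>'"
    and mu_mono: "mono_on {r..R} \<mu>"
    and mu_lower: "c > 0" "\<And>s. s \<in> {r..R} \<Longrightarrow> \<mu> s \<ge> c"
    and phi_deriv: "\<And>s. s \<in> {r..R} \<Longrightarrow> (\<phi> has_real_derivative \<mu>' s / s) (at s within {r..R})"
    and psi: "\<psi> = (\<lambda>t x. \<phi> (\<rho> t x))"
    and periodic: "\<And>t. t \<in> {0..T} \<Longrightarrow> torus_periodic (\<rho> t)"
      "\<And>t. t \<in> {0..T} \<Longrightarrow> torus_periodic (w t)"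
      "\<And>t. t \<in> {0..T} \<Longrightarrow> torus_periodic (\<pi> t)"
    and rho_range: "\<And>t x. t \<in> {0..T} \<Longrightarrow> r \<le> \<rho> t x \<and> \<rho> t x \<le> R"
    and smooth: "sufficiently_smooth T \<rho> w \<psi> \<pi>\<^sub>1"
    and pressure: "\<And>t x. t \<in> {0..T} \<Longrightarrow>
      \<pi>\<^sub>1 t x = \<pi> t x + 2 * (\<mu>' (\<rho> t x) * \<rho> t x - \<mu> (\<rho> t x)) * divg (u t) x
        - lam (\<rho> t x) * divg (u t) x"
    and continuity: "\<And>t x. t \<in> {0..T} \<Longrightarrow>
      dt T \<rho> t x + divg (\<lambda>y. \<rho> t y *\<^sub>R u t y) x = 0"
    and momentum: "\<And>t x. t \<in> {0..T} \<Longrightarrow>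
      dt T (\<lambda>s y. \<rho> s y *\<^sub>R w s y) t x
        + mdiv (\<lambda>y. tensor (\<rho> t y *\<^sub>R u t y) (w t y)) x
        - 2 *\<^sub>R mdiv (\<lambda>y. \<mu> (\<rho> t y) *\<^sub>R sym_grad (u t) y) x
        + (2 * \<kappa>) *\<^sub>R mdiv (\<lambda>y. \<mu> (\<rho> t y) *\<^sub>R transpose (vgrad (u t) y)) x
        + grad (\<pi>\<^sub>1 t) x = 0"
    and w_u: "\<And>t x. t \<in> {0..T} \<Longrightarrow> w t x = u t x + (2 * \<kappa>) *\<^sub>R grad (\<psi> t) x"
    and div_w: "\<And>t x. t \<in> {0..T} \<Longrightarrow> divg (w t) x = 0"
  shows
    "(SUP \<tau>\<in>{0..T}. ereal (
        torus_integral (\<lambda>x. \<rho> \<tau> x *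
          ((norm (w \<tau> x))\<^sup>2 / 2 + (1 - \<kappa>) * \<kappa> * ((norm (2 *\<^sub>R grad (\<psi> \<tau>) x))\<^sup>2 / 2)))
      + 2 * \<kappa> * integral {0..\<tau>} (\<lambda>t. torus_integral (\<lambda>x.
          \<mu> (\<rho> t x) * (norm (skew_grad (w t) x))\<^sup>2))
      + 2 * (1 - \<kappa>) * integral {0..\<tau>} (\<lambda>t. torus_integral (\<lambda>x.
          \<mu> (\<rho> t x) *
          (norm (sym_grad (\<lambda>y. w t y - (2 * \<kappa>) *\<^sub>R grad (\<psi> t) y) x
                 + (2 * \<kappa> / d * laplacian (\<psi> t) x) *\<^sub>R mat 1))\<^sup>2))
      + 2 * (1 - \<kappa>) * integral {0..\<tau>} (\<lambda>t. torus_integral (\<lambda>x.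
          ((1 - d) / d * \<mu> (\<rho> t x) + \<mu>' (\<rho> t x) * \<rho> t x) *
          \<bar>2 * \<kappa> * laplacian (\<psi> t) x\<bar>\<^sup>2))))
     \<le> ereal (torus_integral (\<lambda>x. \<rho> 0 x *
          ((norm (w 0 x))\<^sup>2 / 2 + (1 - \<kappa>) * \<kappa> * ((norm (2 *\<^sub>R grad (\<psi> 0) x))\<^sup>2 / 2))))"
proof -
  note smooth' = smooth[unfolded sufficiently_smooth_def]
  have slab: "C1_slab T \<rho>" "C1_slab T w" "C1_slab T \<psi>" "\<And>i. C1_slab T (\<lambda>t. pd i (\<psi> t))"
    using smooth' by auto
  have space: "C1_space T \<rho>" "C1_space T w" "C1_space T \<psi>" "C1_space T \<pi>\<^sub>1" "\<And>i. C1_space T (\<lambda>t. pd i (w t))"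
      "\<And>i. C1_space T (\<lambda>t. pd i (\<psi> t))" "\<And>i j. C1_space T (\<lambda>t. pd j (pd i (\<psi> t)))"
    using smooth' by (auto simp: C1_slab_def)
  define W where "W j t x = w t x $ j" for j t x
  define m where "m t x = \<mu> (\<rho> t x)" for t x
  define q where "q t x = \<mu>' (\<rho> t x)" for t x
  define U where "U j t x = W j t x - 2 * \<kappa> * pd j (\<psi> t) x" for j t x
  define L where "L t x = (\<Sum>i\<in>UNIV. pd i (pd i (\<psi> t)) x)" for t x

  have \<rho>_mem: "\<rho> t x \<in> {r..R}" if "t \<in> {0..T}" for t x
    using rho_range[OF that, of x] by simp
  have \<rho>_pos: "\<rho> t x > 0" if "t \<in> {0..T}" for t x
    using rho_range[OF that, of x] rR by simp

  \<comment> \<open>At each time the fields are periodic of class \<open>C\<^sup>1\<close>, as the balance laws require.\<close>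
  have C1\<rho>: "C1_periodic (\<rho> t)" if "t \<in> {0..T}" for t
    by (rule C1_space_slice[OF space(1) that periodic(1)[OF that]])
  have C1m: "C1_periodic (m t)" and pdm: "pd i (m t) x = q t x * pd i (\<rho> t) x" if "t \<in> {0..T}" for t i x
    using C1_periodic_compose[OF C1\<rho>[OF that] \<rho>_mem[OF that] mu_deriv mu_C1]
    unfolding m_def[abs_def] q_def by auto
  have pos: "s > 0" if "s \<in> {r..R}" for s
    using that rR by simp
  have cont\<phi>': "continuous_on {r..R} (\<lambda>s. \<mu>' s / s)"
    using pos by (intro continuous_intros mu_C1) force
  have C1\<psi>: "C1_periodic (\<psi> t)" and pd\<psi>: "pd i (\<psi> t) x = q t x / \<rho> t x * pd i (\<rho> t) x"
    if "t \<in> {0..T}" for t i x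
    using C1_periodic_compose[OF C1\<rho>[OF that] \<rho>_mem[OF that] phi_deriv cont\<phi>']
    unfolding psi q_def by auto
  have C1pd\<psi>: "C1_periodic (pd i (\<psi> t))" if "t \<in> {0..T}" for t i
    using C1\<psi>[OF that] by (intro C1_space_slice[OF space(6) that] torus_periodic_pd)
      (auto simp: C1_periodic_def)
  have C1pdpd\<psi>: "C1_periodic (pd j (pd i (\<psi> t)))" if "t \<in> {0..T}" for t i j
    using C1pd\<psi>[OF that] by (intro C1_space_slice[OF space(7) that torus_periodic_pd])
      (auto simp: C1_periodic_def)
  have W: "C1_space T (W j)" and pdW: "t \<in> {0..T} \<Longrightarrow> pd i (W j t) x = pd i (w t) x $ j" for j t i x
    using C1_space_component[where j=j, OF space(2)] unfolding W_def[abs_def] by auto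
  have C1W: "C1_periodic (W j t)" if "t \<in> {0..T}" for t j
    using periodic(2)[OF that] by (intro C1_space_slice[OF W that]) (simp add: torus_periodic_def W_def)
  have spacepdW: "C1_space T (\<lambda>t. pd i (W j t))" for i j
  proof -
    have "C1_space T (\<lambda>t. pd i (W j t)) = C1_space T (\<lambda>t x. pd i (w t) x $ j)"
      by (rule C1_space_cong) (auto simp: pdW fun_eq_iff)
    then show ?thesis
      using C1_space_component(1)[OF space(5)] by simp
  qed
  have C1pdW: "C1_periodic (pd i (W j t))" if "t \<in> {0..T}" for t i j
    using C1W[OF that] by (intro C1_space_slice[OF spacepdW that] torus_periodic_pd)
      (auto simp: C1_periodic_def)
  have C1U: "C1_periodic (U j t)" if "t \<in> {0..T}" for t j
    unfolding U_def[abs_def] by (intro C1_periodic_intros C1W C1pd\<psi> that)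
  have pdU: "pd i (U j t) x = pd i (W j t) x - 2 * \<kappa> * pd i (pd j (\<psi> t)) x" if "t \<in> {0..T}" for i j t x
    unfolding U_def[abs_def]
    using C1_periodic_pd_diff[OF C1W[OF that] C1_periodic_mult[OF C1_periodic_const C1pd\<psi>[OF that]]]
      C1_periodic_pd_const_mult[OF C1pd\<psi>[OF that]] by simp
  have C1pdU: "C1_periodic (pd i (U j t))" if "t \<in> {0..T}" for t i j
    using pdU[OF that] C1_periodic_diff[OF C1pdW[OF that] C1_periodic_mult[OF C1_periodic_const C1pdpd\<psi>[OF that]]]
    by (simp add: fun_eq_iff[symmetric, of "pd i (U j t)"] ext[of "pd i (U j t)"])
  have u: "u t x $ j = U j t x" if "t \<in> {0..T}" for t x j
    using w_u[OF that, of x] by (simp add: U_def W_def grad_def)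
  have divu: "divg (u t) x = (\<Sum>i\<in>UNIV. pd i (U i t) x)" if "t \<in> {0..T}" for t x
    by (simp add: divg_def u[OF that])
  have divw: "(\<Sum>i\<in>UNIV. pd i (W i t) x) = 0" if "t \<in> {0..T}" for t x
    using div_w[OF that, of x] by (simp add: divg_def W_def[abs_def])
  \<comment> \<open>Periodicity is given for \<open>\<pi>\<close> and passes to \<open>\<pi>\<^sub>1\<close> through the formula for the modified pressure.\<close>
  have C1\<pi>: "C1_periodic (\<pi>\<^sub>1 t)" if t: "t \<in> {0..T}" for t
  proof (rule C1_space_slice[OF space(4) t])
    have "torus_periodic (pd i (U i t))" for i
      by (rule C1_periodic_torus_periodic[OF C1pdU[OF t]])
    then show "torus_periodic (\<pi>\<^sub>1 t)"
      using periodic(1,3)[OF t] by (simp add: torus_periodic_def pressure[OF t] divu[OF t])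
  qed

  have mass: "dt T \<rho> t x + (\<Sum>i\<in>UNIV. pd i (\<lambda>y. \<rho> t y * U i t y) x) = 0" if "t \<in> {0..T}" for t x
    using continuity[OF that, of x] by (simp add: divg_def u[OF that])
  have d\<rho>: "((\<lambda>s. \<rho> s x) has_vector_derivative dt T \<rho> t x) (at t within {0..T})"
    if "t \<in> {0..T}" for t x
    by (rule C1_slab_has_vector_derivative_dt[OF slab(1) that])
  have dt\<psi>: "dt T \<psi> t x = q t x / \<rho> t x * dt T \<rho> t x" if t: "t \<in> {0..T}" for t x
  proof (rule dt_eqI[OF T t])
    have "(\<phi> has_real_derivative q t x / \<rho> t x) (at (\<rho> t x) within (\<lambda>s. \<rho> s x) ` {0..T})"
      unfolding q_def using phi_deriv[OF \<rho>_mem[OF t]] \<rho>_mem by (blast intro: DERIV_subset)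
    from field_vector_diff_chain_within[OF d\<rho>[OF t] this]
    show "((\<lambda>s. \<psi> s x) has_vector_derivative q t x / \<rho> t x * dt T \<rho> t x) (at t within {0..T})"
      by (simp add: psi o_def mult.commute)
  qed
  have drift: "dt T \<psi> t x + (\<Sum>i\<in>UNIV. U i t x * pd i (\<psi> t) x) + q t x * (\<Sum>i\<in>UNIV. pd i (U i t) x) = 0"
    if t: "t \<in> {0..T}" for t x
  proof -
    have a: "dt T \<rho> t x = - (\<Sum>i\<in>UNIV. \<rho> t x * pd i (U i t) x + pd i (\<rho> t) x * U i t x)"
      using mass[OF t, of x] by (simp add: C1_periodic_pd_mult C1\<rho>[OF t] C1U[OF t])
    show ?thesis
      unfolding dt\<psi>[OF t] a using \<rho>_pos[OF t, of x]
      by (simp add: pd\<psi>[OF t] sum_3 field_simps)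
  qed

  \<comment> \<open>the components of the time derivative of the momentum \<open>\<rho> w\<close>\<close>
  define f where "f j t x = \<rho> t x * dt T w t x $ j + dt T \<rho> t x * W j t x" for j t x
  have dtm: "dt T (\<lambda>s y. \<rho> s y *\<^sub>R w s y) t x = \<rho> t x *\<^sub>R dt T w t x + dt T \<rho> t x *\<^sub>R w t x"
    if t: "t \<in> {0..T}" for t x
    using d\<rho>[OF t, of x] C1_slab_has_vector_derivative_dt[OF slab(2) t, of x]
    by (intro dt_eqI[OF T t] has_vector_derivative_scaleR)
      (auto simp: has_real_derivative_iff_has_vector_derivative)
  have mom: "f j t x + (\<Sum>i\<in>UNIV. pd i (\<lambda>y. \<rho> t y * U i t y * W j t y) x)
        - (\<Sum>i\<in>UNIV. pd i (\<lambda>y. m t y * (pd i (U j t) y + pd j (U i t) y) - 2 * \<kappa> * m t y * pd j (U i t) y) x)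
        + pd j (\<pi>\<^sub>1 t) x = 0" if t: "t \<in> {0..T}" for t j x
  proof -
    have 1: "mdiv (\<lambda>y. tensor (\<rho> t y *\<^sub>R u t y) (w t y)) x $ j
        = (\<Sum>i\<in>UNIV. pd i (\<lambda>y. \<rho> t y * U i t y * W j t y) x)"
      by (simp add: mdiv_def tensor_def u[OF t] W_def)
    have 2: "mdiv (\<lambda>y. \<mu> (\<rho> t y) *\<^sub>R sym_grad (u t) y) x $ j
        = (\<Sum>i\<in>UNIV. pd i (\<lambda>y. m t y * (1/2 * (pd i (U j t) y + pd j (U i t) y))) x)"
      by (simp add: mdiv_def sym_grad_def vgrad_def transpose_def u[OF t] m_def)
    have 3: "mdiv (\<lambda>y. \<mu> (\<rho> t y) *\<^sub>R transpose (vgrad (u t) y)) x $ j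
        = (\<Sum>i\<in>UNIV. pd i (\<lambda>y. m t y * pd j (U i t) y) x)"
      by (simp add: mdiv_def vgrad_def transpose_def u[OF t] m_def)
    have split: "pd i (\<lambda>y. m t y * (pd i (U j t) y + pd j (U i t) y) - 2 * \<kappa> * m t y * pd j (U i t) y) x
        = 2 * pd i (\<lambda>y. m t y * (1/2 * (pd i (U j t) y + pd j (U i t) y))) x
          - 2 * \<kappa> * pd i (\<lambda>y. m t y * pd j (U i t) y) x" for i
      by (simp only: C1_periodic_pd C1_periodic_intros C1pdU C1m t pd_const) (simp add: algebra_simps)
    have "dt T (\<lambda>s y. \<rho> s y *\<^sub>R w s y) t x $ j
        + mdiv (\<lambda>y. tensor (\<rho> t y *\<^sub>R u t y) (w t y)) x $ j
        - 2 * mdiv (\<lambda>y. \<mu> (\<rho> t y) *\<^sub>R sym_grad (u t) y) x $ j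
        + (2 * \<kappa>) * mdiv (\<lambda>y. \<mu> (\<rho> t y) *\<^sub>R transpose (vgrad (u t) y)) x $ j
        + grad (\<pi>\<^sub>1 t) x $ j = 0"
      using arg_cong[OF momentum[OF t, of x], of "\<lambda>v. v $ j"] by simp
    then show ?thesis
      unfolding 1 2 3 split by (simp add: dtm[OF t] f_def W_def grad_def sum_subtractf sum_distrib_left)
  qed

  \<comment> \<open>Joint continuity allows differentiation under the integral and integration of the dissipation in time.\<close>
  let ?S = "{0..T} \<times> (UNIV :: (real^3) set)"
  have joint: "continuous_on ?S (\<lambda>z. \<rho> (fst z) (snd z))" "continuous_on ?S (\<lambda>z. W j (fst z) (snd z))"
      "continuous_on ?S (\<lambda>z. pd i (W j (fst z)) (snd z))" "continuous_on ?S (\<lambda>z. pd i (\<psi> (fst z)) (snd z))"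
      "continuous_on ?S (\<lambda>z. pd j (pd i (\<psi> (fst z))) (snd z))" "continuous_on ?S (\<lambda>z. dt T \<rho> (fst z) (snd z))"
      "continuous_on ?S (\<lambda>z. dt T w (fst z) (snd z))" "continuous_on ?S (\<lambda>z. dt T \<psi> (fst z) (snd z))"
      "continuous_on ?S (\<lambda>z. dt T (\<lambda>t. pd i (\<psi> t)) (fst z) (snd z))" for i j
    by (intro C1_space_continuous C1_slab_continuous_dt slab space W spacepdW)+
  have cont\<mu>: "continuous_on {r..R} \<mu>"
    using mu_deriv by (meson DERIV_continuous_on)
  have joint': "continuous_on ?S (\<lambda>z. m (fst z) (snd z))" "continuous_on ?S (\<lambda>z. q (fst z) (snd z))"
    unfolding m_def q_def using \<rho>_mem
    by (auto intro!: continuous_on_compose2[OF cont\<mu> joint(1)] continuous_on_compose2[OF mu_C1 joint(1)])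
  have jointU: "continuous_on ?S (\<lambda>z. pd i (U j (fst z)) (snd z))" for i j
  proof -
    have "continuous_on ?S (\<lambda>z. pd i (W j (fst z)) (snd z) - 2 * \<kappa> * pd i (pd j (\<psi> (fst z))) (snd z))"
      by (intro continuous_intros joint)
    then show ?thesis
      by (rule continuous_on_eq) (auto simp: pdU)
  qed
  have jointL: "continuous_on ?S (\<lambda>z. L (fst z) (snd z))"
    unfolding L_def by (intro continuous_intros joint)

  \<comment> \<open>the energy density with the squared norms written out: \<open>|2v|\<^sup>2/2\<close> is \<open>2|v|\<^sup>2\<close>\<close>
  define en where "en t x = \<rho> t x * ((\<Sum>j\<in>UNIV. W j t x * W j t x) / 2
      + 2 * (1 - \<kappa>) * \<kappa> * (\<Sum>i\<in>UNIV. pd i (\<psi> t) x * pd i (\<psi> t) x))" for t x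
  define en' where "en' t x = dt T \<rho> t x * ((\<Sum>j\<in>UNIV. W j t x * W j t x) / 2
      + 2 * (1 - \<kappa>) * \<kappa> * (\<Sum>i\<in>UNIV. pd i (\<psi> t) x * pd i (\<psi> t) x))
    + \<rho> t x * ((\<Sum>j\<in>UNIV. W j t x * dt T w t x $ j)
      + 4 * (1 - \<kappa>) * \<kappa> * (\<Sum>i\<in>UNIV. pd i (\<psi> t) x * dt T (\<lambda>t. pd i (\<psi> t)) t x))" for t x
  define Q1 where "Q1 t x = m t x * (\<Sum>i\<in>UNIV. \<Sum>j\<in>UNIV. ((pd i (W j t) x - pd j (W i t) x) / 2)\<^sup>2)" for t x
  define Q2 where "Q2 t x = m t x * (\<Sum>i\<in>UNIV. \<Sum>j\<in>UNIV.
            ((pd i (U j t) x + pd j (U i t) x) / 2 + 2 * \<kappa> / 3 * L t x * (if i = j then 1 else 0))\<^sup>2)" for t x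
  define Q3 where "Q3 t x = ((1 - 3) / 3 * m t x + q t x * \<rho> t x) * (2 * \<kappa> * L t x)\<^sup>2" for t x
  have jointQ: "continuous_on ?S (\<lambda>z. Q1 (fst z) (snd z))" "continuous_on ?S (\<lambda>z. Q2 (fst z) (snd z))"
      "continuous_on ?S (\<lambda>z. Q3 (fst z) (snd z))"
    unfolding Q1_def Q2_def Q3_def by (intro continuous_intros joint joint' jointU jointL; simp)+
  have joint_en': "continuous_on ?S (\<lambda>z. en' (fst z) (snd z))"
    unfolding en'_def by (intro continuous_intros joint; simp)

  have d_en: "((\<lambda>s. en s x) has_vector_derivative en' t x) (at t within {0..T})" if t: "t \<in> {0..T}" for t x
  proof -
    have d: "((\<lambda>s. \<rho> s x) has_real_derivative dt T \<rho> t x) (at t within {0..T})"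
      "((\<lambda>s. pd i (\<psi> s) x) has_real_derivative dt T (\<lambda>t. pd i (\<psi> t)) t x) (at t within {0..T})"
      "((\<lambda>s. W j s x) has_real_derivative dt T w t x $ j) (at t within {0..T})" for i j
      using d\<rho>[OF t, of x] C1_slab_has_vector_derivative_dt[OF slab(4) t]
        bounded_linear.has_vector_derivative[OF bounded_linear_vec_nth C1_slab_has_vector_derivative_dt[OF slab(2) t]]
      by (auto simp: has_real_derivative_iff_has_vector_derivative W_def)
    have sq: "((\<lambda>s. \<Sum>j\<in>UNIV. W j s x * W j s x) has_real_derivative (\<Sum>j\<in>UNIV. 2 * (W j t x * dt T w t x $ j)))
        (at t within {0..T})"
      "((\<lambda>s. \<Sum>i\<in>UNIV. pd i (\<psi> s) x * pd i (\<psi> s) x) has_real_derivative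
        (\<Sum>i\<in>UNIV. 2 * (pd i (\<psi> t) x * dt T (\<lambda>t. pd i (\<psi> t)) t x))) (at t within {0..T})"
      by (auto intro!: derivative_eq_intros d sum.cong)
    show ?thesis
      unfolding en_def en'_def has_real_derivative_iff_has_vector_derivative[symmetric]
      by (rule DERIV_cong[OF DERIV_mult'[OF d(1) DERIV_add[OF DERIV_cdivide[OF sq(1)] DERIV_cmult[OF sq(2)]]]])
        (simp add: sum_distrib_left[symmetric] algebra_simps)
  qed
  have dE: "((\<lambda>s. torus_integral (en s)) has_vector_derivative torus_integral (en' t)) (at t within {0..T})"
    if t: "t \<in> {0..T}" for t
  proof (rule torus_integral_leibniz[OF d_en _ _ t])
    show "continuous_on ?S (\<lambda>(t, x). en' t x)"
      using joint_en' by (simp add: split_beta)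
    have "continuous_on ?S (\<lambda>z. en (fst z) (snd z))"
      unfolding en_def by (intro continuous_intros joint; simp)
    then show "continuous_on UNIV (en s)" if "s \<in> {0..T}" for s
      using continuous_on_slice that by blast
  qed

  have rate: "torus_integral (en' t) = - (2 * \<kappa> * torus_integral (Q1 t)
      + 2 * (1 - \<kappa>) * torus_integral (Q2 t) + 2 * (1 - \<kappa>) * torus_integral (Q3 t))"
    if t: "t \<in> {0..T}" for t
  proof -
    define K1 where "K1 x = (\<Sum>j\<in>UNIV. W j t x * f j t x) - dt T \<rho> t x * (\<Sum>j\<in>UNIV. W j t x * W j t x) / 2" for x
    define K2 where "K2 x = dt T \<rho> t x * (\<Sum>i\<in>UNIV. pd i (\<psi> t) x * pd i (\<psi> t) x) / 2
        - (\<Sum>i\<in>UNIV. pd i (\<lambda>y. \<rho> t y * pd i (\<psi> t) y) x) * dt T \<psi> t x" for x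
    \<comment> \<open>The defect between the time derivative of the energy of \<open>\<nabla>\<psi>\<close> and \<open>K2\<close>; its integral vanishes.\<close>
    define Z where "Z x = (\<Sum>i\<in>UNIV. \<rho> t x * pd i (\<psi> t) x * dt T (\<lambda>t. pd i (\<psi> t)) t x)
        + (\<Sum>i\<in>UNIV. pd i (\<lambda>y. \<rho> t y * pd i (\<psi> t) y) x) * dt T \<psi> t x" for x
    have Z: "torus_integral Z = 0"
      unfolding Z_def[abs_def]
      by (rule torus_integral_time_derivative_gradient[where \<psi>=\<psi> and g="\<lambda>i x. \<rho> t x * pd i (\<psi> t) x", OF T t])
        (auto intro!: C1\<psi> C1_periodic_mult C1\<rho> C1pd\<psi> t C1_slab_has_vector_derivative_dt slab joint)
    have slice: "continuous_on UNIV (dt T \<rho> t)" "continuous_on UNIV (dt T w t)" "continuous_on UNIV (dt T \<psi> t)"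
        "continuous_on UNIV (dt T (\<lambda>t. pd i (\<psi> t)) t)" "continuous_on UNIV (q t)" for i
      by (auto intro: continuous_on_slice[OF _ t] joint joint')
    have atoms: "continuous_on UNIV (\<rho> t)" "continuous_on UNIV (W j t)" "continuous_on UNIV (pd i (\<psi> t))"
        "continuous_on UNIV (pd i (\<lambda>y. \<rho> t y * pd i (\<psi> t) y))" for i j
      by (intro C1_periodic_continuous C1_periodic_continuous_pd C1_periodic_mult C1\<rho> C1W C1pd\<psi> t)+
    have grad_m: "pd i (m t) x = \<rho> t x * pd i (\<psi> t) x" "q t x * pd i (\<rho> t) x = \<rho> t x * pd i (\<psi> t) x" for i x
      using \<rho>_pos[OF t, of x] by (simp_all add: pdm[OF t] pd\<psi>[OF t])
    have U: "U = (\<lambda>j t x. W j t x - 2 * \<kappa> * pd j (\<psi> t) x)"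
      by (simp add: U_def fun_eq_iff)
    have K: "continuous_on UNIV K1" "continuous_on UNIV K2" "continuous_on UNIV Z"
      unfolding K1_def K2_def Z_def f_def by (intro continuous_intros slice atoms; simp)+
    have "en' t x = K1 x + (4 * \<kappa> * (1 - \<kappa>)) * (K2 x + Z x)" for x
      unfolding en'_def K1_def K2_def Z_def f_def
      by (simp add: sum_3 field_simps)
    then have "torus_integral (en' t) = torus_integral (\<lambda>x. K1 x + (4 * \<kappa> * (1 - \<kappa>)) * (K2 x + Z x))"
      by presburger
    also have "\<dots> = torus_integral K1 + 4 * \<kappa> * (1 - \<kappa>) * torus_integral K2"
    proof -
      have "torus_integral (\<lambda>x. K1 x + (4 * \<kappa> * (1 - \<kappa>)) * (K2 x + Z x))
          = torus_integral K1 + torus_integral (\<lambda>x. (4 * \<kappa> * (1 - \<kappa>)) * (K2 x + Z x))"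
        by (intro torus_integral_add continuous_intros K)
      then show ?thesis
        unfolding torus_integral_mult torus_integral_add[OF K(2,3)] Z by simp
    qed
    also have "\<dots> = - (2 * \<kappa> * torus_integral (Q1 t)
      + 2 * (1 - \<kappa>) * torus_integral (Q2 t) + 2 * (1 - \<kappa>) * torus_integral (Q3 t))"
      unfolding K1_def[abs_def] K2_def[abs_def] Q1_def[abs_def] Q2_def[abs_def] Q3_def[abs_def] L_def U
      by (rule energy_dissipation_rate[where w="\<lambda>j. W j t" and \<psi>="\<psi> t" and \<rho>="\<rho> t" and m="m t"
          and q="q t" and p="\<pi>\<^sub>1 t" and f="\<lambda>j. f j t" and a="dt T \<rho> t" and b="dt T \<psi> t" and \<kappa>=\<kappa>,
          OF C1\<rho>[OF t] C1m[OF t] C1\<pi>[OF t] C1\<psi>[OF t] C1W[OF t] C1pdW[OF t] C1pd\<psi>[OF t] C1pdpd\<psi>[OF t]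
            slice(5) grad_m(1,2) mass[OF t, unfolded U] drift[OF t, unfolded U] mom[OF t, unfolded U] divw[OF t]])
    finally show ?thesis .
  qed

  have balance: "torus_integral (en \<tau>) + 2 * \<kappa> * integral {0..\<tau>} (\<lambda>t. torus_integral (Q1 t))
      + 2 * (1 - \<kappa>) * integral {0..\<tau>} (\<lambda>t. torus_integral (Q2 t))
      + 2 * (1 - \<kappa>) * integral {0..\<tau>} (\<lambda>t. torus_integral (Q3 t)) = torus_integral (en 0)"
    if \<tau>: "\<tau> \<in> {0..T}" for \<tau>
  proof -
    have "((\<lambda>t. torus_integral (en' t)) has_integral torus_integral (en \<tau>) - torus_integral (en 0)) {0..\<tau>}"
      using \<tau> by (intro fundamental_theorem_of_calculus has_vector_derivative_within_subset[OF dE]) auto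
    moreover have int: "(\<lambda>t. torus_integral (Q1 t)) integrable_on {0..\<tau>}" "(\<lambda>t. torus_integral (Q2 t)) integrable_on {0..\<tau>}"
       "(\<lambda>t. torus_integral (Q3 t)) integrable_on {0..\<tau>}"
      using \<tau> by (auto intro!: integrable_continuous_interval continuous_on_subset[OF torus_integral_continuous] jointQ)
    have "((\<lambda>t. - (2 * \<kappa> * torus_integral (Q1 t)
      + 2 * (1 - \<kappa>) * torus_integral (Q2 t) + 2 * (1 - \<kappa>) * torus_integral (Q3 t))) has_integral
       - (2 * \<kappa> * integral {0..\<tau>} (\<lambda>t. torus_integral (Q1 t))
      + 2 * (1 - \<kappa>) * integral {0..\<tau>} (\<lambda>t. torus_integral (Q2 t))
      + 2 * (1 - \<kappa>) * integral {0..\<tau>} (\<lambda>t. torus_integral (Q3 t)))) {0..\<tau>}"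
      by (intro has_integral_neg has_integral_add has_integral_mult_right integrable_integral int)
    then have "((\<lambda>t. torus_integral (en' t)) has_integral
       - (2 * \<kappa> * integral {0..\<tau>} (\<lambda>t. torus_integral (Q1 t))
      + 2 * (1 - \<kappa>) * integral {0..\<tau>} (\<lambda>t. torus_integral (Q2 t))
      + 2 * (1 - \<kappa>) * integral {0..\<tau>} (\<lambda>t. torus_integral (Q3 t)))) {0..\<tau>}"
      by (rule has_integral_eq[rotated]) (use \<tau> in \<open>simp add: rate\<close>)
    ultimately have "torus_integral (en \<tau>) - torus_integral (en 0)
      = - (2 * \<kappa> * integral {0..\<tau>} (\<lambda>t. torus_integral (Q1 t))
      + 2 * (1 - \<kappa>) * integral {0..\<tau>} (\<lambda>t. torus_integral (Q2 t))
      + 2 * (1 - \<kappa>) * integral {0..\<tau>} (\<lambda>t. torus_integral (Q3 t)))"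
      by (rule has_integral_unique)
    then show ?thesis
      by linarith
  qed

  \<comment> \<open>It remains to write the integrands of the statement in components.\<close>
  have en: "\<rho> t x * ((norm (w t x))\<^sup>2 / 2 + (1 - \<kappa>) * \<kappa> * ((norm (2 *\<^sub>R grad (\<psi> t) x))\<^sup>2 / 2)) = en t x" for t x
    by (simp add: en_def W_def grad_def power2_norm_eq_inner inner_vec_def sum_3 field_simps)
  have Q1: "\<mu> (\<rho> t x) * (norm (skew_grad (w t) x))\<^sup>2 = Q1 t x" for t x
  proof -
    have "skew_grad (w t) x $ i $ j = (pd i (W j t) x - pd j (W i t) x) / 2" for i j
      by (simp add: skew_grad_def vgrad_def transpose_def W_def[abs_def])
    then show ?thesis
      by (simp only: Q1_def m_def norm_matrix_power2)
  qed
  have lap: "laplacian (\<psi> t) x = L t x" for t x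
    by (simp add: laplacian_def divg_def grad_def L_def)
  have Q2: "\<mu> (\<rho> t x) * (norm (sym_grad (\<lambda>y. w t y - (2 * \<kappa>) *\<^sub>R grad (\<psi> t) y) x
                 + (2 * \<kappa> / d * laplacian (\<psi> t) x) *\<^sub>R mat 1))\<^sup>2 = Q2 t x" for t x
  proof -
    have "(sym_grad (\<lambda>y. w t y - (2 * \<kappa>) *\<^sub>R grad (\<psi> t) y) x
        + (2 * \<kappa> / d * laplacian (\<psi> t) x) *\<^sub>R mat 1) $ i $ j
      = (pd i (U j t) x + pd j (U i t) x) / 2 + 2 * \<kappa> / 3 * L t x * (if i = j then 1 else 0)" for i j
      by (simp add: sym_grad_def vgrad_def transpose_def grad_def U_def[abs_def] W_def lap d mat_def)
    then show ?thesis
      by (simp only: Q2_def m_def norm_matrix_power2)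
  qed
  have Q3: "((1 - d) / d * \<mu> (\<rho> t x) + \<mu>' (\<rho> t x) * \<rho> t x) * \<bar>2 * \<kappa> * laplacian (\<psi> t) x\<bar>\<^sup>2 = Q3 t x" for t x
    by (simp only: Q3_def m_def q_def lap d power2_abs)
  show ?thesis
    unfolding en Q1 Q2 Q3 by (rule SUP_least) (simp only: balance order_refl)
qed

end
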